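(* Let $\Omega \subset \mathbb{C}^{n}$ be a pluri-finely open set. Then every pluri-finely connected component of $\Omega$ is pluri-finely open. Moreover, the set of these components is at most countable.
   Context: The pluri-fine topology on $\mathbb{C}^n$ is the coarsest topology on $\mathbb{C}^n$ making all plurisubharmonic functions $\varphi : \mathbb{C}^n \to [-\infty,\infty)$ continuous. "Pluri-finely open" means open in this topology, and the pluri-finely connected components of $\Omega$ are the connected components of $\Omega$ with respect to the topology induced on $\Omega$ by the pluri-fine topology. *)

theory Defs
  imports "HOL-Analysis.Analysis"
begin

text \<open>
  The mean value of \<open>u\<close> over the circle of centre \<open>a\<close> and radius \<open>r\<close>, as the integral of the
  positive part minus that of the negative part. For upper semicontinuous \<open>u < \<infinity>\<close> the positive
  part is bounded on the circle, so the first integral is finite and the difference is well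
  defined, with value \<open>-\<infinity>\<close> when the negative part is not integrable.
  (\<open>e2ennreal\<close> maps negative numbers to 0.)
\<close>

definition circle_mean :: "(complex \<Rightarrow> ereal) \<Rightarrow> complex \<Rightarrow> real \<Rightarrow> ereal" where
  "circle_mean u a r =
    (enn2ereal (\<integral>\<^sup>+ t \<in> {0..2 * pi}. e2ennreal (u (a + rcis r t)) \<partial>lborel)
     - enn2ereal (\<integral>\<^sup>+ t \<in> {0..2 * pi}. e2ennreal (- u (a + rcis r t)) \<partial>lborel))
    / ereal (2 * pi)"

definition usc :: "('a::topological_space \<Rightarrow> ereal) \<Rightarrow> bool" where
  "usc f \<longleftrightarrow> (\<forall>c. open {x. f x < c})"

text \<open>
  Functions with values in \<open>[-\<infinity>,\<infinity>)\<close> are functions into \<^typ>\<open>ereal\<close> omitting \<open>\<infinity>\<close>. The constant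
  \<open>-\<infinity>\<close> counts as subharmonic, so that ``subharmonic or identically \<open>-\<infinity>\<close> on every complex line''
  is just subharmonicity along every complex line.
\<close>

definition subharmonic :: "(complex \<Rightarrow> ereal) \<Rightarrow> bool" where
  "subharmonic u \<longleftrightarrow>
    (\<forall>z. u z < \<infinity>) \<and> usc u \<and> (\<forall>a r. 0 < r \<longrightarrow> u a \<le> circle_mean u a r)"

definition plurisubharmonic :: "(complex ^ 'n \<Rightarrow> ereal) \<Rightarrow> bool" where
  "plurisubharmonic \<phi> \<longleftrightarrow>
    (\<forall>z. \<phi> z < \<infinity>) \<and> usc \<phi> \<and> (\<forall>a b. subharmonic (\<lambda>w. \<phi> (a + w *s b)))"

definition plurifine_topology :: "(complex ^ 'n) topology" where
  "plurifine_topology = topology_generated_by {\<phi> -` U | \<phi> U. plurisubharmonic \<phi> \<and> open U}"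

text \<open>
  The next three facts say that this is the coarsest topology on the whole space making all
  plurisubharmonic functions continuous as maps into \<open>[-\<infinity>,\<infinity>)\<close>.
\<close>

lemma topspace_plurifine_topology [simp]:
  "topspace (plurifine_topology :: (complex ^ 'n) topology) = UNIV"
proof -
  have "plurisubharmonic ((\<lambda>_. - \<infinity>) :: complex ^ 'n \<Rightarrow> ereal)"
    by (simp add: plurisubharmonic_def subharmonic_def usc_def)
  then have "UNIV \<in> {\<phi> -` U | (\<phi> :: complex ^ 'n \<Rightarrow> ereal) U. plurisubharmonic \<phi> \<and> open U}"
    by (metis (mono_tags, lifting) mem_Collect_eq open_UNIV vimage_UNIV)
  then show ?thesis
    unfolding plurifine_topology_def topology_generated_by_topspace by blast
qed

lemma continuous_map_plurifine_topology:
  assumes "plurisubharmonic \<phi>"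
  shows "continuous_map plurifine_topology (top_of_set {..<\<infinity>}) \<phi>"
proof -
  have "continuous_map plurifine_topology euclidean \<phi>"
    unfolding continuous_map_alt
  proof (intro conjI allI impI)
    fix U :: "ereal set"
    assume "openin euclidean U"
    then have "openin plurifine_topology (\<phi> -` U)"
      unfolding plurifine_topology_def
      using assms by (intro topology_generated_by_Basis) auto
    then show "openin plurifine_topology (\<phi> -` U \<inter> topspace plurifine_topology)"
      by simp
  qed auto
  then show ?thesis
    using assms by (auto simp: continuous_map_in_subtopology plurisubharmonic_def)
qed

lemma plurifine_topology_coarsest:
  fixes T :: "(complex ^ 'n) topology"
  assumes "topspace T = UNIV"
    and "\<And>\<phi>. plurisubharmonic \<phi> \<Longrightarrow> continuous_map T (top_of_set {..<\<infinity>}) \<phi>"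
    and "openin plurifine_topology S"
  shows "openin T S"
proof -
  have "openin T B" if "B \<in> {\<phi> -` U | \<phi> U. plurisubharmonic \<phi> \<and> open U}" for B
  proof -
    from that obtain \<phi> U where "B = \<phi> -` U" "plurisubharmonic \<phi>" "open U"
      by blast
    moreover from this have "continuous_map T euclidean \<phi>"
      using assms(2) continuous_map_in_subtopology by blast
    ultimately show ?thesis
      using assms(1) by (auto simp: continuous_map_alt)
  qed
  moreover have "generate_topology_on {\<phi> -` U | \<phi> U. plurisubharmonic \<phi> \<and> open U} S"
    using assms(3) unfolding plurifine_topology_def by (rule openin_topology_generated_by)
  ultimately show ?thesis
    using generate_topology_on_coarsest[OF istopology_openin] by blast
qed

end

theory Submission
  imports Defs "HOL-Complex_Analysis.Cauchy_Integral_Formula"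
begin

text \<open>
  Near a point \<open>a\<close> of a pluri-finely open set \<open>\<Omega>\<close> one finds a real plurisubharmonic \<open>\<Phi> \<le> 0\<close> with
  \<open>\<Phi> a\<close> as close to \<open>0\<close> as desired and \<open>{\<Phi> \<ge> -1} \<subseteq> \<Omega>\<close>. Comparing \<open>\<Phi>\<close> on complex lines with
  potentials of the kernel \<open>(\<bar>w\<bar> / \<bar>z - w\<bar>)\<^sup>1\<^sup>/\<^sup>2\<close> shows that the set \<open>{\<Phi> < -1}\<close> is small near \<open>a\<close> in two ways:
  its trace on a real segment issuing from \<open>a\<close> has small relative length, and in any fixed range of
  directions some segment issuing from \<open>a\<close> avoids it altogether.

  By the first property, splitting a real segment into two relatively pluri-finely open pieces would
  give a Lipschitz function whose difference quotients are close to \<open>1\<close> at the points of one piece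
  and close to \<open>0\<close> at those of the other. This contradicts the Darboux property, so segments are
  pluri-finely connected. By the second property, \<open>a\<close> is joined inside \<open>\<Omega>\<close> to every \<open>z\<close> near it with
  \<open>\<Phi> z\<close> close to \<open>0\<close> by a segment from \<open>a\<close> and a segment from \<open>z\<close> that meet. Hence components are
  open. They are countably many because a nonempty pluri-finely open set contains a Borel set of
  positive Lebesgue measure.
\<close>

section \<open>Potential estimates in the plane\<close>

lemma circle_trig_has_integral:
  fixes A B C :: real
  shows "((\<lambda>t. A + B * cos t + C * sin t) has_integral 2 * pi * A) {0..2*pi}"
proof -
  have "((\<lambda>t. A + B * cos t + C * sin t) has_integral
      (A * (2*pi) + B * sin (2*pi) - C * cos (2*pi)) - (A * 0 + B * sin 0 - C * cos 0)) {0..2*pi}"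
    by (intro fundamental_theorem_of_calculus)
      (auto intro!: derivative_eq_intros simp flip: has_real_derivative_iff_has_vector_derivative)
  then show ?thesis by (simp add: mult.commute)
qed

text \<open>This is Cauchy's integral formula on \<open>circlepath z r\<close>, with the factor
  \<open>\<i>\<close> coming from the derivative of the path cancelled by
  \<open>- \<i>\<close>.\<close>

lemma holomorphic_circle_mean:
  fixes f :: "complex \<Rightarrow> complex"
  assumes "0 < r" "f holomorphic_on cball z r"
  shows "((\<lambda>t. f (z + rcis r t)) has_integral 2 * pi * f z) {0..2*pi}"
proof -
  have "((\<lambda>u. f u / (u - z)) has_contour_integral (2 * of_real pi * \<i> * f z)) (circlepath z r)"
    using assms by (intro Cauchy_integral_circlepath)
      (auto intro: holomorphic_on_imp_continuous_on elim: holomorphic_on_subset)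
  then have "((\<lambda>t. f (z + r * cis t) / (r * cis t) * r * \<i> * cis t) has_integral
      (2 * of_real pi * \<i> * f z)) {0..2*pi}"
    unfolding circlepath_def by (subst (asm) has_contour_integral_part_circlepath_iff) auto
  then have "((\<lambda>t. f (z + r * cis t) / (r * cis t) * r * \<i> * cis t * (- \<i>)) has_integral
      (2 * of_real pi * \<i> * f z) * (- \<i>)) {0..2*pi}"
    by (rule has_integral_mult_left)
  moreover have "2 * of_real pi * \<i> * f z * (- \<i>) = 2 * pi * f z"
    by (simp add: complex_eq_iff)
  ultimately have "((\<lambda>t. f (z + r * cis t) / (r * cis t) * r * \<i> * cis t * (- \<i>)) has_integral
      2 * pi * f z) {0..2*pi}"
    by (simp only:)
  then show ?thesis
    using assms(1) by (simp add: rcis_def mult.assoc)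
qed

text \<open>Up to the factor \<open>sqrt (norm p)\<close>, the kernel is the modulus of the
  holomorphic function \<open>1 / csqrt (1 + z / p)\<close>. On the disc \<open>1 + z / p\<close>
  has positive real part, so the principal branch is holomorphic there, and the mean value property
  together with the triangle inequality gives the bound. Thus the kernel is subharmonic away from
  its pole.\<close>

lemma inverse_sqrt_norm_circle_mean:
  fixes p :: complex
  assumes "0 < r" "r < norm p"
  shows "2 * pi * (1 / sqrt (norm p)) \<le> integral {0..2*pi} (\<lambda>t. 1 / sqrt (norm (p + rcis r t)))"
proof -
  define f where "f z = 1 / csqrt (1 + z / p)" for z
  have p0: "p \<noteq> 0" using assms by auto
  have pos: "1 + z / p \<notin> \<real>\<^sub>\<le>\<^sub>0" "1 + z / p \<noteq> 0" if "z \<in> cball 0 r" for z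
  proof -
    have "norm (z / p) < 1"
      using that assms p0 by (auto simp: norm_divide divide_simps)
    then have "\<bar>Re (z / p)\<bar> < 1" using abs_Re_le_cmod le_less_trans by blast
    then have "Re (1 + z / p) > 0" by simp
    then show "1 + z / p \<notin> \<real>\<^sub>\<le>\<^sub>0" "1 + z / p \<noteq> 0"
      by (auto simp: complex_nonpos_Reals_iff simp del: plus_complex.sel)
  qed
  have hol: "f holomorphic_on cball 0 r"
    unfolding f_def using pos p0 by (intro holomorphic_intros) auto
  have int: "((\<lambda>t. f (rcis r t)) has_integral 2 * pi * f 0) {0..2*pi}"
    using holomorphic_circle_mean[OF assms(1) hol] by simp
  have nf: "norm (f z) = sqrt (norm p) * (1 / sqrt (norm (p + z)))" for z
  proof -
    have "1 + z / p = (p + z) / p" using p0 by (simp add: field_simps)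
    then show ?thesis
      by (simp add: f_def norm_divide real_sqrt_divide)
  qed
  have mem: "rcis r t \<in> cball 0 r" for t using assms by simp
  have cont: "continuous_on {0..2*pi} (\<lambda>t. f (rcis r t))"
    using assms(1) unfolding rcis_def
    by (intro continuous_on_compose2[OF holomorphic_on_imp_continuous_on[OF hol]] continuous_intros)
       (auto simp: norm_mult)
  have "2 * pi = norm (integral {0..2*pi} (\<lambda>t. f (rcis r t)))"
    using int by (simp add: integral_unique f_def)
  also have "\<dots> \<le> integral {0..2*pi} (\<lambda>t. norm (f (rcis r t)))"
    using cont by (intro integral_norm_bound_integral integrable_continuous_interval continuous_intros) auto
  also have "\<dots> = sqrt (norm p) * integral {0..2*pi} (\<lambda>t. 1 / sqrt (norm (p + rcis r t)))"
    unfolding nf by (rule integral_mult_right)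
  finally show ?thesis
    using p0 by (simp add: field_simps)
qed

text \<open>
  Truncating from below makes subharmonic functions real-valued, so that sums and means are
  ordinary integrals.
\<close>

definition rsubharmonic :: "(complex \<Rightarrow> real) \<Rightarrow> bool" where
  "rsubharmonic v \<longleftrightarrow> (\<forall>c. open {z. v z < c}) \<and> (\<exists>L. \<forall>z. L \<le> v z) \<and>
    (\<forall>z r. 0 < r \<longrightarrow> 2 * pi * v z \<le> integral {0..2*pi} (\<lambda>t. v (z + rcis r t)))"

section \<open>Semicontinuous functions\<close>

lemma usc_bounded_above:
  fixes f :: "'a::topological_space \<Rightarrow> real"
  assumes "\<And>c. open {z. f z < c}" "compact X"
  obtains B where "\<And>z. z \<in> X \<Longrightarrow> f z \<le> B"
proof -
  have "X \<subseteq> \<Union> (range (\<lambda>n::nat. {z. f z < real n}))"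
    using reals_Archimedean2 by auto
  then obtain D where D: "D \<subseteq> range (\<lambda>n::nat. {z. f z < real n})" "finite D" "X \<subseteq> \<Union>D"
    using compactE[OF assms(2), of "range (\<lambda>n::nat. {z. f z < real n})"] assms(1) by auto
  then obtain N where N: "finite N" "D = (\<lambda>n::nat. {z. f z < real n}) ` N"
    by (meson finite_subset_image)
  have "f z \<le> real (Max N)" if z: "z \<in> X" for z
  proof -
    obtain n where "n \<in> N" "f z < real n" using z D(3) N(2) by auto
    then show ?thesis using Max_ge[OF N(1)] by (meson less_le_trans less_imp_le of_nat_le_iff)
  qed
  then show ?thesis using that by blast
qed

text \<open>Semicontinuity is asked only relative to \<open>X\<close>, because the function
  maximised in \<open>rsubharmonic_comparison\<close> contains a summand that is continuous only off
  a closed set. If no maximum existed, each \<open>x\<close> would have a neighbourhood on which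
  \<open>f\<close> stays below a larger value \<open>f (h x)\<close>; the largest of these values
  over a finite subcover is then exceeded by another one of them.\<close>

lemma usc_attains_max:
  fixes f :: "'a::topological_space \<Rightarrow> real"
  assumes "compact X" "X \<noteq> {}"
    and "\<And>x c. x \<in> X \<Longrightarrow> f x < c \<Longrightarrow> \<exists>U. open U \<and> x \<in> U \<and> (\<forall>y\<in>X \<inter> U. f y < c)"
  obtains x where "x \<in> X" "\<And>y. y \<in> X \<Longrightarrow> f y \<le> f x"
proof (rule ccontr)
  assume "\<not> thesis"
  then have "\<forall>x\<in>X. \<exists>y\<in>X. f x < f y" using that by (meson not_le)
  then obtain h where h: "\<And>x. x \<in> X \<Longrightarrow> h x \<in> X \<and> f x < f (h x)" by metis
  then have "\<forall>x\<in>X. \<exists>U. open U \<and> x \<in> U \<and> (\<forall>y\<in>X \<inter> U. f y < f (h x))"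
    using assms(3) by blast
  then obtain U where U: "\<And>x. x \<in> X \<Longrightarrow> open (U x) \<and> x \<in> U x \<and> (\<forall>y\<in>X \<inter> U x. f y < f (h x))"
    by metis
  obtain D where D: "D \<subseteq> X" "finite D" "X \<subseteq> (\<Union>x\<in>D. U x)"
    using compactE_image[OF assms(1), of X U] U by blast
  have "D \<noteq> {}" using D assms(2) by auto
  then obtain x where x: "x \<in> D" "\<And>y. y \<in> D \<Longrightarrow> f (h y) \<le> f (h x)"
  proof -
    have "finite ((\<lambda>y. f (h y)) ` D)" "(\<lambda>y. f (h y)) ` D \<noteq> {}"
      using D(2) \<open>D \<noteq> {}\<close> by auto
    then have "Max ((\<lambda>y. f (h y)) ` D) \<in> (\<lambda>y. f (h y)) ` D" by (rule Max_in)
    then obtain x where x: "x \<in> D" "Max ((\<lambda>y. f (h y)) ` D) = f (h x)" by auto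
    have "f (h y) \<le> f (h x)" if "y \<in> D" for y
      using that D(2) by (simp flip: x(2))
    then show ?thesis using x(1) that by blast
  qed
  have "h x \<in> X" using x D h by auto
  then obtain y where "y \<in> D" "h x \<in> U y" using D by auto
  then have "f (h x) < f (h y)" using U D \<open>h x \<in> X\<close> by blast
  then show False using x(2)[OF \<open>y \<in> D\<close>] by simp
qed

lemma usc_borel_measurable:
  fixes f :: "'a::topological_space \<Rightarrow> real"
  assumes "\<And>c. open {z. f z < c}"
  shows "f \<in> borel_measurable borel"
  using assms by (simp add: borel_measurable_iff_less borel_open)

lemma rcis_measurable [measurable]: "(\<lambda>t. rcis r t) \<in> borel_measurable borel"
  unfolding rcis_def by (intro borel_measurable_continuous_onI continuous_intros)

lemma usc_set_integrable_circle:
  fixes v :: "'a::real_normed_vector \<Rightarrow> real" and q :: "real \<Rightarrow> 'a"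
  assumes v: "\<And>c. open {z. v z < c}" and L: "\<And>z. L \<le> v z" and q: "continuous_on UNIV q"
  shows "set_integrable lborel {a..b} (\<lambda>t. v (q t))"
proof -
  have "compact (q ` {a..b})"
    using q by (intro compact_continuous_image) (auto intro: continuous_on_subset)
  then obtain B where B: "\<And>z. z \<in> q ` {a..b} \<Longrightarrow> v z \<le> B"
    using usc_bounded_above[OF v] by blast
  have [measurable]: "(\<lambda>t. v (q t)) \<in> borel_measurable borel"
    using measurable_compose[OF borel_measurable_continuous_onI[OF q] usc_borel_measurable[OF v]] .
  show ?thesis
    unfolding set_integrable_def
  proof (rule integrableI_bounded_set[where A = "{a..b}" and B = "max \<bar>B\<bar> \<bar>L\<bar>"])
    have "\<bar>v (q t)\<bar> \<le> max \<bar>B\<bar> \<bar>L\<bar>" if "t \<in> {a..b}" for t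
      using B[of "q t"] L[of "q t"] that by auto
    then show "AE t in lborel. t \<in> {a..b} \<longrightarrow> norm (indicator {a..b} t *\<^sub>R v (q t)) \<le> max \<bar>B\<bar> \<bar>L\<bar>"
      by simp
  qed (auto simp: emeasure_lborel_Icc_eq)
qed

lemma rsubharmonic_integrable_circle:
  assumes "rsubharmonic v"
  shows "(\<lambda>t. v (z + rcis r t)) integrable_on {a..b}"
proof -
  obtain L where "\<And>z. L \<le> v z" "\<And>c. open {z. v z < c}"
    using assms unfolding rsubharmonic_def by blast
  then have "set_integrable lborel {a..b} (\<lambda>t. v (z + rcis r t))"
    by (intro usc_set_integrable_circle) (auto simp: rcis_def intro!: continuous_intros)
  then show ?thesis by (rule set_borel_integral_eq_integral(1))
qed

section \<open>Comparison with potentials and thinness\<close>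

text \<open>A maximum principle for \<open>C * v + g - m\<close> on the disc. It is negative where
  \<open>v < -1\<close>, because \<open>g \<le> C\<close>; it is nonpositive on the bounding circle,
  because \<open>v \<le> 0\<close> and \<open>g \<le> m\<close>; elsewhere both summands satisfy the
  sub-mean inequality on small circles.\<close>

lemma rsubharmonic_comparison:
  fixes v g :: "complex \<Rightarrow> real"
  assumes v: "rsubharmonic v" and R: "0 < R" and v0: "\<And>z. z \<in> cball 0 R \<Longrightarrow> v z \<le> 0"
    and K: "closed K" "\<And>z. z \<in> K \<Longrightarrow> v z < -1"
    and C: "0 < C" "\<And>z. g z \<le> C" and m: "0 \<le> m" "\<And>z. norm z = R \<Longrightarrow> g z \<le> m"
    and gcont: "continuous_on (- K) g"
    and gmean: "\<And>z r. 0 < r \<Longrightarrow> cball z r \<inter> K = {} \<Longrightarrow>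
       2 * pi * g z \<le> integral {0..2*pi} (\<lambda>t. g (z + rcis r t))"
  shows "C * v 0 \<le> m - g 0"
proof (rule ccontr)
  assume neg: "\<not> ?thesis"
  define \<delta> where "\<delta> = C * v 0 + g 0 - m"
  have \<delta>: "0 < \<delta>" using neg by (simp add: \<delta>_def)
  \<comment> \<open>The term \<open>\<epsilon> * (norm z)^2\<close> makes the sub-mean inequality
    strict. This choice of \<open>\<epsilon>\<close> leaves
    \<open>f 0 = \<delta> / 2\<close>.\<close>
  define \<epsilon> where "\<epsilon> = \<delta> / (2 * R^2)"
  have \<epsilon>: "0 < \<epsilon>" using \<delta> R by (simp add: \<epsilon>_def)
  define f where "f z = C * v z + g z - m + \<epsilon> * ((norm z)^2 - R^2)" for z
  have f0: "f 0 > 0" using \<delta> R by (simp add: f_def \<epsilon>_def \<delta>_def)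
  have low: "f z < 0" if "z \<in> cball 0 R" "v z < -1" for z
  proof -
    have "C * v z < - C" using C(1) that by (metis mult.right_neutral mult_minus_right mult_strict_left_mono)
    moreover have "(norm z)^2 - R^2 \<le> 0" using that R by (auto simp: power_mono)
    then have "\<epsilon> * ((norm z)^2 - R^2) \<le> 0" using \<epsilon> by (simp add: mult_nonneg_nonpos)
    ultimately show ?thesis using C(2)[of z] m unfolding f_def by linarith
  qed
  have vopen: "open {z. v z < c}" for c using v by (simp add: rsubharmonic_def)
  \<comment> \<open>\<open>X\<close> is compact and disjoint from \<open>K\<close>, and
    \<open>f\<close> is negative on the rest of the disc, so a positive maximum over
    \<open>X\<close> is a maximum over the whole disc.\<close>
  define X where "X = cball 0 R - {z. v z < -1}"
  have "compact X" unfolding X_def using vopen compact_diff compact_cball by blast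
  have X0: "0 \<in> X" using low[of 0] f0 R unfolding X_def by fastforce
  have fusc: "\<exists>U. open U \<and> x \<in> U \<and> (\<forall>y\<in>X \<inter> U. f y < c)" if x: "x \<in> X" "f x < c" for x c
  proof -
    define e where "e = (c - f x) / 2"
    have e: "0 < e" using x by (simp add: e_def)
    define h where "h z = g z + \<epsilon> * ((norm z)^2 - R^2)" for z
    have "x \<in> - K" using x K unfolding X_def by auto
    have "continuous_on (- K) h" unfolding h_def by (intro continuous_intros gcont)
    moreover have "open (- K)" using K by auto
    ultimately have "open (- K \<inter> h -` {..<h x + e})"
      by (rule continuous_open_preimage) simp
    moreover have "open {z. v z < v x + e / C}" by (rule vopen)
    moreover have "f y < c" if "h y < h x + e" "v y < v x + e / C" for y
    proof -
      have "C * v y < C * v x + e" using that C(1) by (simp add: field_simps)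
      then show ?thesis using that(1) unfolding f_def h_def e_def by (simp add: field_simps)
    qed
    ultimately show ?thesis
      using \<open>x \<in> - K\<close> e C(1)
      by (intro exI[of _ "(- K \<inter> h -` {..<h x + e}) \<inter> {z. v z < v x + e / C}"]) auto
  qed
  obtain z where z: "z \<in> X" "\<And>y. y \<in> X \<Longrightarrow> f y \<le> f z"
    using usc_attains_max[OF \<open>compact X\<close> _ fusc] X0 by (metis empty_iff)
  have fz: "0 < f z" using z(2)[OF X0] f0 by simp
  have zR: "z \<in> cball 0 R" using z(1) by (simp add: X_def)
  have "norm z \<noteq> R"
  proof
    assume "norm z = R"
    moreover have "C * v z \<le> 0" using C(1) v0[OF zR] by (simp add: mult_nonneg_nonpos)
    ultimately have "f z \<le> 0" using m(2)[of z] unfolding f_def by simp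
    then show False using fz by simp
  qed
  then have "z \<in> ball 0 R" using zR by auto
  moreover have "z \<in> - K" using z(1) K unfolding X_def by auto
  moreover have "open (ball 0 R \<inter> - K)" using K by auto
  ultimately obtain r where r: "0 < r" "cball z r \<subseteq> ball 0 R \<inter> - K"
    by (metis IntI open_contains_cball)
  define q where "q t = z + rcis r t" for t
  have qr: "q t \<in> cball z r" for t using r by (simp add: q_def dist_norm)
  \<comment> \<open>The circle may leave \<open>X\<close>, but there \<open>low\<close> makes
    \<open>f\<close> negative while \<open>f z\<close> is positive.\<close>
  have fq: "f (q t) \<le> f z" for t
  proof (cases "v (q t) < -1")
    case True
    then show ?thesis using low[of "q t"] qr[of t] r fz by fastforce
  next
    case False
    then have "q t \<in> X" using qr[of t] r by (auto simp: X_def)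
    then show ?thesis using z by blast
  qed
  \<comment> \<open>As a trigonometric polynomial in \<open>t\<close>, the quadratic term has the
    explicit mean \<open>(norm z)^2 + r^2\<close>; the surplus \<open>\<epsilon> * r^2\<close>
    contradicts maximality at \<open>z\<close>.\<close>
  have nq: "(norm (q t))^2 = ((norm z)^2 + r^2) + (2 * r * Re z) * cos t + (2 * r * Im z) * sin t" for t
  proof -
    have "(norm (q t))^2 = (Re z + r * cos t)^2 + (Im z + r * sin t)^2"
      by (simp add: q_def cmod_power2)
    also have "\<dots> = ((Re z)^2 + (Im z)^2) + r^2 * ((cos t)^2 + (sin t)^2) + (2 * r * Re z) * cos t + (2 * r * Im z) * sin t"
      by algebra
    finally show ?thesis by (simp add: cmod_power2)
  qed
  have iv: "(\<lambda>t. v (q t)) integrable_on {0..2*pi}"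
    unfolding q_def by (rule rsubharmonic_integrable_circle[OF v])
  have cq: "continuous_on A q" for A unfolding q_def rcis_def by (intro continuous_intros)
  have ig: "(\<lambda>t. g (q t)) integrable_on {0..2*pi}"
    using r qr by (intro integrable_continuous_interval continuous_on_compose2[OF gcont cq]) blast
  have "((\<lambda>t. C * v (q t) + g (q t) + (- m - \<epsilon> * R^2 + \<epsilon> * (norm (q t))^2)) has_integral
     (C * integral {0..2*pi} (\<lambda>t. v (q t)) + integral {0..2*pi} (\<lambda>t. g (q t)) +
      2*pi*(- m - \<epsilon> * R^2 + \<epsilon> * ((norm z)^2 + r^2)))) {0..2*pi}" (is "(?F has_integral ?I) _")
  proof (intro has_integral_add has_integral_mult_right)
    have "((\<lambda>t. (- m - \<epsilon> * R^2 + \<epsilon> * ((norm z)^2 + r^2)) + (\<epsilon>*(2 * r * Re z)) * cos t + (\<epsilon>*(2 * r * Im z)) * sin t)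
      has_integral 2*pi*(- m - \<epsilon> * R^2 + \<epsilon> * ((norm z)^2 + r^2))) {0..2*pi}"
      by (rule circle_trig_has_integral)
    then show "((\<lambda>t. - m - \<epsilon> * R^2 + \<epsilon> * (norm (q t))^2) has_integral 2*pi*(- m - \<epsilon> * R^2 + \<epsilon> * ((norm z)^2 + r^2))) {0..2*pi}"
      unfolding nq by (simp add: algebra_simps)
  qed (use iv ig in \<open>auto intro: integrable_integral\<close>)
  moreover have "((\<lambda>t. f z) has_integral 2*pi * f z) {0..2*pi}"
    using has_integral_const_real[of "f z" 0 "2*pi"] by simp
  moreover have "?F t \<le> f z" for t using fq[of t] unfolding f_def by (simp add: algebra_simps)
  ultimately have "?I \<le> 2 * pi * f z" by (rule has_integral_le)
  moreover have "2*pi * g z \<le> integral {0..2*pi} (\<lambda>t. g (q t))"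
    unfolding q_def using r by (intro gmean) auto
  moreover have "C * (2*pi * v z) \<le> C * integral {0..2*pi} (\<lambda>t. v (q t))"
    using v r(1) C(1) unfolding q_def rsubharmonic_def by (intro mult_left_mono) auto
  moreover have "2 * pi * (\<epsilon> * r^2) > 0" using \<epsilon> r by simp
  ultimately show False unfolding f_def by (simp add: algebra_simps)
qed

text \<open>The antiderivative \<open>2 * sgn (t - \<tau>) * sqrt \<bar>t - \<tau>\<bar>\<close> is
  continuous across the singularity, so \<open>\<tau>\<close> enters the fundamental theorem as an
  exceptional point. What matters is that the bound does not depend on \<open>\<tau>\<close>; the
  number 6 comes from the crude estimate \<open>sqrt 2 \<le> 3/2\<close>.\<close>

lemma inverse_sqrt_nn_integral_le:
  fixes \<tau> :: real
  shows "(\<integral>\<^sup>+t\<in>{-1..1}. ennreal (1 / sqrt \<bar>t - \<tau>\<bar>) \<partial>lborel) \<le> 6"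
proof -
  define F where "F t = 2 * sgn (t - \<tau>) * sqrt \<bar>t - \<tau>\<bar>" for t :: real
  have F: "F t = 2 * (if \<tau> \<le> t then sqrt (t - \<tau>) else - sqrt (\<tau> - t))" for t
    by (auto simp: F_def sgn_if)
  have "continuous_on ({..\<tau>} \<union> {\<tau>..}) (\<lambda>t. if \<tau> \<le> t then sqrt (t - \<tau>) else - sqrt (\<tau> - t))"
  proof -
    have "continuous_on ({\<tau>..} \<union> {..\<tau>}) (\<lambda>t. if \<tau> \<le> t then sqrt (t - \<tau>) else - sqrt (\<tau> - t))"
      by (rule continuous_on_If) (auto intro!: continuous_intros)
    then show ?thesis by (simp add: Un_commute)
  qed
  moreover have "{..\<tau>} \<union> {\<tau>..} = UNIV" by auto
  ultimately have contF: "continuous_on A F" for A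
    unfolding F by (intro continuous_intros) (auto intro: continuous_on_subset)
  have "((\<lambda>t. 1 / sqrt \<bar>t - \<tau>\<bar>) has_integral F 1 - F (-1)) {-1..1}"
  proof (rule fundamental_theorem_of_calculus_interior_strong[where S = "{\<tau>}"])
    fix t assume "t \<in> {-1<..<1} - {\<tau>}"
    then consider "t < \<tau>" | "t > \<tau>" by force
    then have "(F has_real_derivative 1 / sqrt \<bar>t - \<tau>\<bar>) (at t)"
    proof cases
      case 1
      have "((\<lambda>t. - 2 * sqrt (\<tau> - t)) has_real_derivative 1 / sqrt \<bar>t - \<tau>\<bar>) (at t)"
        using 1 by (auto intro!: derivative_eq_intros simp: field_simps)
      moreover have "eventually (\<lambda>t. F t = - 2 * sqrt (\<tau> - t)) (nhds t)"
        using 1 by (intro eventually_nhds_in_open[of "{..<\<tau>}", THEN eventually_mono]) (auto simp: F)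
      ultimately show ?thesis by (subst DERIV_cong_ev[OF refl _ refl])
    next
      case 2
      have "((\<lambda>t. 2 * sqrt (t - \<tau>)) has_real_derivative 1 / sqrt \<bar>t - \<tau>\<bar>) (at t)"
        using 2 by (auto intro!: derivative_eq_intros simp: field_simps)
      moreover have "eventually (\<lambda>t. F t = 2 * sqrt (t - \<tau>)) (nhds t)"
        using 2 by (intro eventually_nhds_in_open[of "{\<tau><..}", THEN eventually_mono]) (auto simp: F)
      ultimately show ?thesis by (subst DERIV_cong_ev[OF refl _ refl])
    qed
    then show "(F has_vector_derivative 1 / sqrt \<bar>t - \<tau>\<bar>) (at t)"
      by (simp add: has_real_derivative_iff_has_vector_derivative)
  qed (auto intro: contF)
  then have "(\<integral>\<^sup>+t\<in>{-1..1}. ennreal (1 / sqrt \<bar>t - \<tau>\<bar>) \<partial>lborel) = ennreal (F 1 - F (-1))"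
    by (intro nn_integral_has_integral_lebesgue') auto
  moreover have "F 1 - F (-1) \<le> 6"
  proof -
    have s2: "sqrt x \<le> 3/2" if "x \<le> 2" for x :: real
      using that by (intro real_le_lsqrt) (auto simp: power2_eq_square)
    have add: "sqrt (x + 2) \<le> sqrt x + 3/2" if "0 \<le> x" for x :: real
      using sqrt_add_le_add_sqrt[of x 2] s2[of 2] that by simp
    consider "\<tau> \<le> -1" | "-1 < \<tau>" "\<tau> \<le> 1" | "1 < \<tau>" by linarith
    then show ?thesis
    proof cases
      case 1 then show ?thesis using add[of "-1-\<tau>"] by (simp add: F)
    next
      case 2 then show ?thesis using s2[of "1-\<tau>"] s2[of "1+\<tau>"] by (auto simp: F algebra_simps)
    next
      case 3 then show ?thesis using add[of "\<tau>-1"] by (simp add: F algebra_simps)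
    qed
  qed
  ultimately show ?thesis
    by (metis ennreal_leI ennreal_numeral)
qed

text \<open>
  The kernel \<open>\<bar>w\<bar> / \<bar>z - w\<bar>\<close> is invariant under scaling, so that one bound for the potential serves
  points \<open>w t\<close> at all distances from \<open>0\<close>.
\<close>

lemma thinness_estimate:
  fixes w :: "real \<Rightarrow> complex"
  assumes v: "rsubharmonic v" and r: "0 < r" and v0: "\<And>z. z \<in> cball 0 (5 * r) \<Longrightarrow> v z \<le> 0"
    and K: "compact K" "\<And>z. z \<in> K \<Longrightarrow> v z < -1" "0 \<notin> K"
    and w[measurable]: "w \<in> borel_measurable borel" and F[measurable]: "F \<in> sets borel" and F1: "F \<subseteq> {-1..1}"
    and wK: "\<And>t. t \<in> F \<Longrightarrow> w t \<in> K" and wr: "\<And>t. t \<in> F \<Longrightarrow> norm (w t) \<le> r"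
    and c: "0 < c" "\<And>z. \<exists>\<tau>. \<forall>t\<in>F. norm (w t) * \<bar>t - \<tau>\<bar> \<le> c * norm (z - w t)"
  shows "v 0 \<le> - measure lborel F / (12 * sqrt c)"
proof -
  \<comment> \<open>At the pole \<open>z = w t\<close>, division by zero gives the kernel the value
    0.\<close>
  define k where "k t z = sqrt (norm (w t) / norm (z - w t))" for t z
  have k0: "0 \<le> k t z" for t z by (simp add: k_def)
  have km[measurable]: "(\<lambda>(t,z). k t z) \<in> borel_measurable (borel \<Otimes>\<^sub>M borel)"
    unfolding k_def by measurable
  have km1[measurable]: "(\<lambda>t. k t z) \<in> borel_measurable borel" for z
    unfolding k_def by measurable
  define G where "G z = (\<integral>\<^sup>+t\<in>F. ennreal (k t z) \<partial>lborel)" for z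
  define g where "g z = (LINT t:F|lborel. k t z)" for z
  \<comment> \<open>Hypothesis \<open>c\<close> dominates the kernel by
    \<open>sqrt c / sqrt \<bar>t - \<tau>\<bar>\<close> for \<open>t \<noteq> \<tau>\<close>, so the
    one-dimensional integral bounds the potential uniformly in \<open>z\<close>.\<close>
  have G6: "G z \<le> ennreal (6 * sqrt c)" for z
  proof -
    obtain \<tau> where \<tau>: "\<And>t. t \<in> F \<Longrightarrow> norm (w t) * \<bar>t - \<tau>\<bar> \<le> c * norm (z - w t)" using c(2) by blast
    have le: "k t z \<le> sqrt c * (1 / sqrt \<bar>t - \<tau>\<bar>)" if "t \<in> F" "t \<noteq> \<tau>" for t
    proof (cases "z = w t")
      case True then show ?thesis using c by (simp add: k_def)
    next
      case False
      then have "norm (w t) / norm (z - w t) \<le> c / \<bar>t - \<tau>\<bar>"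
        using \<tau>[OF that(1)] that(2) by (simp add: field_simps)
      then have "k t z \<le> sqrt (c / \<bar>t - \<tau>\<bar>)" unfolding k_def by (rule real_sqrt_le_mono)
      then show ?thesis by (simp add: real_sqrt_divide)
    qed
    have "G z \<le> (\<integral>\<^sup>+t\<in>{-1..1}. ennreal (sqrt c) * ennreal (1 / sqrt \<bar>t - \<tau>\<bar>) \<partial>lborel)"
      unfolding G_def
    proof (rule nn_integral_mono_AE)
      have "AE t in lborel. t \<noteq> \<tau>" by (rule AE_lborel_singleton)
      then show "AE t in lborel. ennreal (k t z) * indicator F t
           \<le> ennreal (sqrt c) * ennreal (1 / sqrt \<bar>t - \<tau>\<bar>) * indicator {- 1..1} t"
      proof eventually_elim
        case (elim t)
        then show ?case
          using F1 le[of t] c(1) by (auto split: split_indicator simp flip: ennreal_mult intro!: ennreal_leI)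
      qed
    qed
    also have "\<dots> = ennreal (sqrt c) * (\<integral>\<^sup>+t\<in>{-1..1}. ennreal (1 / sqrt \<bar>t - \<tau>\<bar>) \<partial>lborel)"
      by (simp add: mult.assoc nn_integral_cmult)
    also have "\<dots> \<le> ennreal (sqrt c) * 6"
      by (intro mult_left_mono inverse_sqrt_nn_integral_le) simp
    also have "\<dots> = ennreal (6 * sqrt c)"
      using c(1) by (simp add: ennreal_mult mult.commute)
    finally show ?thesis .
  qed
  have Gg: "set_integrable lborel F (\<lambda>t. k t z)" "G z = ennreal (g z)" for z
  proof -
    have eq: "(\<integral>\<^sup>+t. ennreal (indicator F t *\<^sub>R k t z) \<partial>lborel) = G z"
      unfolding G_def by (intro nn_integral_cong) (auto split: split_indicator)
    show i: "set_integrable lborel F (\<lambda>t. k t z)"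
      unfolding set_integrable_def
    proof (rule integrableI_nonneg)
      show "(\<integral>\<^sup>+t. ennreal (indicator F t *\<^sub>R k t z) \<partial>lborel) < \<infinity>"
        unfolding eq using G6[of z] by (simp add: le_less_trans)
    qed (auto simp: k0)
    show "G z = ennreal (g z)"
      unfolding g_def set_lebesgue_integral_def eq[symmetric]
      using i k0 by (intro nn_integral_eq_integral) (auto simp: set_integrable_def)
  qed
  have g0: "0 \<le> g z" for z
    unfolding g_def set_lebesgue_integral_def by (intro integral_nonneg_AE) (auto simp: k0)
  have g6: "g z \<le> 6 * sqrt c" for z
    using G6[of z] Gg(2)[of z] c(1) by simp
  have "F \<in> lmeasurable"
    using F1 F bounded_subset[of "{-1..1::real}" F] by (auto intro: bounded_set_imp_lmeasurable)
  then have Ffin: "emeasure lborel F < \<infinity>"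
    using F by (simp add: fmeasurable_def)
  have iF: "set_integrable lborel F (\<lambda>t. a)" for a :: real
    using Ffin unfolding set_integrable_def by (auto intro!: integrable_scaleR_left)
  have sF: "(LINT t:F|lborel. a) = a * measure lborel F" for a :: real
    using Ffin by (simp add: set_lebesgue_integral_def)
  \<comment> \<open>The normalising factor \<open>norm (w t)\<close> makes the kernel equal to 1 at
    the centre, wherever \<open>w t\<close> lies.\<close>
  have gcenter: "g 0 = measure lborel F"
  proof -
    have "k t 0 = 1" if "t \<in> F" for t using wK[OF that] K(3) by (auto simp: k_def)
    then have "g 0 = (LINT t:F|lborel. 1)"
      unfolding g_def by (intro set_lebesgue_integral_cong) auto
    then show ?thesis by (simp add: sF)
  qed
  \<comment> \<open>The radius \<open>5 * r\<close> keeps the circle at distance at least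
    \<open>4 * r\<close> from all poles, so the kernel is at most \<open>sqrt (1/4)\<close> and the
    potential at most half its value at the centre.\<close>
  have gsphere: "g z \<le> measure lborel F / 2" if z: "norm z = 5 * r" for z
  proof -
    have "k t z \<le> 1/2" if t: "t \<in> F" for t
    proof -
      have "norm (z - w t) \<ge> 4 * r" using norm_triangle_ineq2[of z "w t"] z wr[OF t] by simp
      then have "norm (w t) / norm (z - w t) \<le> 1/4"
        using frac_le[of r "norm (w t)" "4 * r" "norm (z - w t)"] wr[OF t] r by simp
      then have "k t z \<le> sqrt (1/4)" unfolding k_def by (rule real_sqrt_le_mono)
      then show ?thesis by (simp add: real_sqrt_divide)
    qed
    then have "g z \<le> (LINT t:F|lborel. 1/2)"
      unfolding g_def by (intro set_integral_mono Gg iF)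
    then show ?thesis unfolding sF by simp
  qed
  have gcont: "continuous_on (- K) g"
  proof -
    \<comment> \<open>At distance at least \<open>d\<close> from \<open>K\<close> all kernels are
      bounded by \<open>sqrt (r / d)\<close>, which serves as the dominating function.\<close>
    have *: "continuous_on {z. \<forall>y\<in>K. d \<le> dist z y} g" if d: "0 < d" for d
    proof (rule continuous_on_sequentiallyI)
      fix u a assume u: "\<forall>n. u n \<in> {z. \<forall>y\<in>K. d \<le> dist z y}" and a: "a \<in> {z. \<forall>y\<in>K. d \<le> dist z y}"
        and ua: "u \<longlonglongrightarrow> a"
      show "(\<lambda>n. g (u n)) \<longlonglongrightarrow> g a"
        unfolding g_def set_lebesgue_integral_def
      proof (rule integral_dominated_convergence[where w = "\<lambda>t. indicator F t *\<^sub>R sqrt (r / d)"])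
        show "integrable lborel (\<lambda>t. indicator F t *\<^sub>R sqrt (r / d))"
          using iF by (simp add: set_integrable_def)
        show "AE t in lborel. (\<lambda>n. indicator F t *\<^sub>R k t (u n)) \<longlonglongrightarrow> indicator F t *\<^sub>R k t a"
        proof (rule AE_I2)
          fix t
          show "(\<lambda>n. indicator F t *\<^sub>R k t (u n)) \<longlonglongrightarrow> indicator F t *\<^sub>R k t a"
          proof (cases "t \<in> F")
            case True
            then have "norm (a - w t) > 0" using a wK[OF True] d by (auto simp: dist_norm)
            then show ?thesis unfolding k_def by (intro tendsto_intros ua) auto
          qed simp
        qed
        show "AE t in lborel. norm (indicator F t *\<^sub>R k t (u n)) \<le> indicator F t *\<^sub>R sqrt (r / d)" for n
        proof (rule AE_I2)
          fix t
          show "norm (indicator F t *\<^sub>R k t (u n)) \<le> indicator F t *\<^sub>R sqrt (r / d)"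
          proof (cases "t \<in> F")
            case True
            then have "d \<le> norm (u n - w t)" using u wK[OF True] by (auto simp: dist_norm)
            then have "norm (w t) / norm (u n - w t) \<le> r / d"
              using wr[OF True] d r by (intro frac_le) auto
            then show ?thesis using True by (simp add: k_def)
          qed simp
        qed
      qed auto
    qed
    have "isCont g z" if "z \<in> - K" for z
    proof -
      have "open (- K)" using K compact_imp_closed by blast
      from openE[OF this that] obtain e where e: "0 < e" "ball z e \<subseteq> - K" .
      have "continuous_on (ball z (e/2)) g"
      proof (rule continuous_on_subset[OF *[of "e/2"]])
        show "ball z (e/2) \<subseteq> {z. \<forall>y\<in>K. e/2 \<le> dist z y}"
        proof (intro subsetI CollectI ballI)
          fix x y assume "x \<in> ball z (e/2)" "y \<in> K"
          then have "dist z y \<ge> e" using e(2) by (metis ComplD mem_ball not_le subsetD)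
          then show "e/2 \<le> dist x y" using \<open>x \<in> ball z (e/2)\<close> dist_triangle[of z y x] by simp
        qed
      qed (use e in simp)
      then show ?thesis using e(1) by (simp add: continuous_on_eq_continuous_at)
    qed
    then show ?thesis by (simp add: continuous_at_imp_continuous_on)
  qed
  have gmean: "2 * pi * g z \<le> integral {0..2*pi} (\<lambda>t. g (z + rcis s t))"
    if s: "0 < s" "cball z s \<inter> K = {}" for z s
  proof -
    have kmean: "2 * pi * k t z \<le> integral {0..2*pi} (\<lambda>\<theta>. k t (z + rcis s \<theta>))"
      and kint: "(\<lambda>\<theta>. k t (z + rcis s \<theta>)) integrable_on {0..2*pi}" if t: "t \<in> F" for t
    proof -
      have "w t \<notin> cball z s" using s(2) wK[OF t] by auto
      then have *: "s < norm (z - w t)" by (simp add: dist_norm)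
      have k: "k t y = sqrt (norm (w t)) * (1 / sqrt (norm (y - w t)))" for y
        by (simp add: k_def real_sqrt_divide)
      have "2 * pi * k t z \<le> sqrt (norm (w t)) * integral {0..2*pi} (\<lambda>\<theta>. 1 / sqrt (norm (z - w t + rcis s \<theta>)))"
        using mult_left_mono[OF inverse_sqrt_norm_circle_mean[OF s(1) *], of "sqrt (norm (w t))"]
        by (simp add: k mult_ac)
      also have "\<dots> = integral {0..2*pi} (\<lambda>\<theta>. k t (z + rcis s \<theta>))"
        unfolding k integral_mult_right[symmetric] by (simp add: algebra_simps)
      finally show "2 * pi * k t z \<le> integral {0..2*pi} (\<lambda>\<theta>. k t (z + rcis s \<theta>))" .
      have "z + rcis s \<theta> - w t \<noteq> 0" for \<theta>
        using * s(1) norm_triangle_ineq2[of "z - w t" "- rcis s \<theta>"] by (auto simp: algebra_simps)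
      then show "(\<lambda>\<theta>. k t (z + rcis s \<theta>)) integrable_on {0..2*pi}"
        unfolding k_def rcis_def by (intro integrable_continuous_interval continuous_intros) (auto simp: rcis_def)
    qed
    have gi: "(\<lambda>\<theta>. g (z + rcis s \<theta>)) integrable_on {0..2*pi}"
    proof -
      have "z + rcis s \<theta> \<in> - K" for \<theta>
        using s by (auto simp: disjoint_iff dist_norm)
      then show ?thesis
        by (intro integrable_continuous_interval continuous_on_compose2[OF gcont])
           (auto simp: rcis_def intro!: continuous_intros)
    qed
    \<comment> \<open>Tonelli's theorem transfers the sub-mean inequality from the single kernels to
      the potential; nonnegative integrals require no joint integrability.\<close>
    have "ennreal (2 * pi) * G z = (\<integral>\<^sup>+t\<in>F. ennreal (2 * pi * k t z) \<partial>lborel)"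
    proof -
      have "ennreal (2 * pi) * G z = (\<integral>\<^sup>+t. ennreal (2 * pi) * (ennreal (k t z) * indicator F t) \<partial>lborel)"
        unfolding G_def by (rule nn_integral_cmult[symmetric]) measurable
      then show ?thesis by (simp add: ennreal_mult' mult.assoc)
    qed
    also have "\<dots> \<le> (\<integral>\<^sup>+t\<in>F. ennreal (integral {0..2*pi} (\<lambda>\<theta>. k t (z + rcis s \<theta>))) \<partial>lborel)"
      using kmean by (intro nn_integral_mono) (auto split: split_indicator intro!: ennreal_leI)
    also have "\<dots> = (\<integral>\<^sup>+t\<in>F. (\<integral>\<^sup>+\<theta>. ennreal (k t (z + rcis s \<theta>)) * indicator {0..2*pi} \<theta> \<partial>lborel) \<partial>lborel)"
    proof (intro nn_integral_cong)
      fix t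
      have "(\<integral>\<^sup>+\<theta>. ennreal (k t (z + rcis s \<theta>)) * indicator {0..2*pi} \<theta> \<partial>lborel) =
         ennreal (integral {0..2*pi} (\<lambda>\<theta>. k t (z + rcis s \<theta>)))" if "t \<in> F"
        by (rule nn_integral_has_integral_lebesgue'[OF k0 integrable_integral[OF kint[OF that]]])
      then show "ennreal (integral {0..2*pi} (\<lambda>\<theta>. k t (z + rcis s \<theta>))) * indicator F t =
          (\<integral>\<^sup>+\<theta>. ennreal (k t (z + rcis s \<theta>)) * indicator {0..2*pi} \<theta> \<partial>lborel) * indicator F t"
        by (simp split: split_indicator)
    qed
    also have "\<dots> = (\<integral>\<^sup>+t. (\<integral>\<^sup>+\<theta>. ennreal (k t (z + rcis s \<theta>)) * indicator {0..2*pi} \<theta> * indicator F t \<partial>lborel) \<partial>lborel)"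
      by (subst nn_integral_multc) measurable
    also have "\<dots> = (\<integral>\<^sup>+\<theta>. (\<integral>\<^sup>+t. ennreal (k t (z + rcis s \<theta>)) * indicator {0..2*pi} \<theta> * indicator F t \<partial>lborel) \<partial>lborel)"
      by (rule lborel_pair.Fubini'[symmetric]) measurable
    also have "\<dots> = (\<integral>\<^sup>+\<theta>. G (z + rcis s \<theta>) * indicator {0..2*pi} \<theta> \<partial>lborel)"
    proof (rule nn_integral_cong)
      fix \<theta>
      show "(\<integral>\<^sup>+t. ennreal (k t (z + rcis s \<theta>)) * indicator {0..2*pi} \<theta> * indicator F t \<partial>lborel) =
        G (z + rcis s \<theta>) * indicator {0..2*pi} \<theta>"
        by (cases "\<theta> \<in> {0..2*pi}") (simp_all add: G_def)
    qed
    also have "\<dots> = ennreal (integral {0..2*pi} (\<lambda>\<theta>. g (z + rcis s \<theta>)))"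
      unfolding Gg by (rule nn_integral_has_integral_lebesgue'[OF g0 integrable_integral[OF gi]])
    finally show ?thesis
      unfolding Gg using g0 gi by (simp add: ennreal_mult[symmetric] integral_nonneg)
  qed
  \<comment> \<open>The comparison is applied with \<open>C = 6 * sqrt c\<close> and
    \<open>m = measure lborel F / 2\<close>; as \<open>g 0\<close> is the full measure of
    \<open>F\<close>, half of it survives on the right.\<close>
  have "6 * sqrt c * v 0 \<le> measure lborel F / 2 - g 0"
  proof (rule rsubharmonic_comparison[OF v _ v0 _ K(2) _ g6 _ gsphere gcont gmean])
    show "closed K" using K compact_imp_closed by blast
  qed (use r c(1) in auto)
  then show ?thesis
    using c(1) unfolding gcenter by (simp add: field_simps)
qed

text \<open>The curve \<open>w s = h * s\<close> runs along the real axis, where the distance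
  hypothesis of \<open>thinness_estimate\<close> holds with \<open>c = 1\<close>.\<close>

lemma line_thinness:
  assumes v: "rsubharmonic v" and h: "0 < h" and v0: "\<And>z. z \<in> cball 0 (5 * h) \<Longrightarrow> v z \<le> 0"
    and low: "-1 \<le> v 0"
  shows "measure lborel {s \<in> {0..1}. v (of_real (h * s)) < -1} \<le> -12 * v 0"
proof -
  define G where "G = {s \<in> {0..1}. v (of_real (h * s)) < -1}"
  have "v \<in> borel_measurable borel"
    using v by (intro usc_borel_measurable) (simp add: rsubharmonic_def)
  then have "(\<lambda>s. v (of_real (h * s))) \<in> borel_measurable borel"
    by (rule measurable_compose[rotated]) (intro borel_measurable_continuous_onI continuous_intros)
  then have [measurable]: "G \<in> sets borel" unfolding G_def by measurable
  then have G: "G \<in> sets lebesgue" by simp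
  have Gfin: "G \<in> lmeasurable"
    using G by (rule bounded_set_imp_lmeasurable[rotated]) (auto simp: G_def intro: bounded_subset[of "{0..1::real}"])
  have "measure lebesgue G \<le> -12 * v 0 + e" if e: "0 < e" for e
  proof -
    \<comment> \<open>The potential estimate needs a compact set of poles, so \<open>G\<close> is
      exhausted from inside up to measure \<open>e\<close>.\<close>
    obtain F where F: "closed F" "F \<subseteq> G" "G - F \<in> lmeasurable" "emeasure lebesgue (G - F) < ennreal e"
      using sets_lebesgue_inner_closed[OF G e] by metis
    have cF: "compact F"
    proof -
      have "F \<subseteq> {0..1}" using F(2) by (auto simp: G_def)
      then show ?thesis using F(1) by (simp add: compact_eq_bounded_closed bounded_subset[OF bounded_closed_interval])
    qed
    define w where "w s = complex_of_real (h * s)" for s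
    have wc: "continuous_on A w" for A unfolding w_def by (intro continuous_intros)
    have "v 0 \<le> - measure lborel F / (12 * sqrt 1)"
    proof (rule thinness_estimate[OF v h v0, where K = "w ` F" and w = w])
      show "compact (w ` F)" using cF wc by (rule compact_continuous_image[rotated])
      show "v z < -1" if "z \<in> w ` F" for z using that F(2) by (auto simp: G_def w_def)
      then show "0 \<notin> w ` F" using low by force
      show "w \<in> borel_measurable borel" using wc by (rule borel_measurable_continuous_onI)
      show "F \<in> sets borel" using F by (simp add: borel_closed)
      show "F \<subseteq> {-1..1}" using F(2) by (auto simp: G_def)
      show "norm (w t) \<le> h" if "t \<in> F" for t
        using that F(2) h mult_left_le[of t h] by (auto simp: w_def norm_mult G_def)
      show "\<exists>\<tau>. \<forall>t\<in>F. norm (w t) * \<bar>t - \<tau>\<bar> \<le> 1 * norm (z - w t)" for z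
      \<comment> \<open>\<open>\<tau>\<close> is the parameter of the orthogonal projection of
        \<open>z\<close> to the real axis.\<close>
      proof (intro exI[of _ "Re z / h"] ballI)
        fix t assume "t \<in> F"
        then have t: "0 \<le> t" "t \<le> 1" using F(2) by (auto simp: G_def)
        have "norm (w t) * \<bar>t - Re z / h\<bar> = t * (h * \<bar>t - Re z / h\<bar>)"
          using t h by (simp add: w_def norm_mult abs_mult)
        also have "\<dots> \<le> 1 * (h * \<bar>t - Re z / h\<bar>)"
          using t h by (intro mult_right_mono) auto
        also have "h * \<bar>t - Re z / h\<bar> = \<bar>h * (t - Re z / h)\<bar>" using h by (simp add: abs_mult)
        also have "h * (t - Re z / h) = - Re (z - w t)" using h by (simp add: w_def field_simps)
        also have "\<bar>- Re (z - w t)\<bar> \<le> norm (z - w t)" using abs_Re_le_cmod[of "z - w t"] by simp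
        finally show "norm (w t) * \<bar>t - Re z / h\<bar> \<le> 1 * norm (z - w t)" by simp
      qed
    qed auto
    moreover have "measure lebesgue G \<le> measure lebesgue F + measure lebesgue (G - F)"
    proof -
      have "F \<union> (G - F) = G" using F(2) by auto
      then show ?thesis
        using measure_Un_le[of F lebesgue "G - F"] F(3) lmeasurable_compact[OF cF] by (simp add: fmeasurableD)
    qed
    moreover have "measure lebesgue (G - F) < e"
      using F(3,4) e by (simp add: emeasure_eq_measure2 ennreal_less_iff)
    moreover have "measure lebesgue F = measure lborel F"
      using F(1) by (simp add: borel_closed)
    ultimately show ?thesis by simp
  qed
  then have "measure lebesgue G \<le> -12 * v 0"
    by (rule field_le_epsilon)
  then show ?thesis
    unfolding G_def[symmetric] by simp
qed

text \<open>Each inserted set overrides the earlier choice on its own points. In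
  \<open>good_ray\<close> this turns a choice of radii, about which nothing is known, into a
  measurable one.\<close>

lemma finite_measurable_selection:
  fixes \<rho> :: "'b \<Rightarrow> real"
  assumes "finite T" "\<And>t. t \<in> T \<Longrightarrow> S t \<in> sets M"
  shows "\<exists>f\<in>borel_measurable M. \<forall>s\<in>(\<Union>t\<in>T. S t). \<exists>t\<in>T. s \<in> S t \<and> f s = \<rho> t"
  using assms
proof (induction T)
  case empty
  show ?case by (intro bexI[of _ "\<lambda>_. 0"]) auto
next
  case (insert x T)
  then obtain f where f: "f \<in> borel_measurable M" "\<forall>s\<in>(\<Union>t\<in>T. S t). \<exists>t\<in>T. s \<in> S t \<and> f s = \<rho> t"
    by auto
  have "(\<lambda>s. if s \<in> S x then \<rho> x else f s) \<in> borel_measurable M"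
    using f(1) insert.prems[of x] by measurable
  then show ?case
    using f(2) by (intro bexI[of _ "\<lambda>s. if s \<in> S x then \<rho> x else f s"]) auto
qed

text \<open>If \<open>z\<close> has slope at most 2 in modulus, \<open>\<tau>\<close> is that slope,
  and \<open>\<rho> * \<bar>t - \<tau>\<bar>\<close> is controlled by the distance to the line
  through 0 and \<open>z\<close>. Otherwise \<open>z\<close> is outside a neighbourhood of the cone,
  its distance is at least \<open>\<rho> / 3\<close>, and \<open>\<tau> = 0\<close> works. The
  constant does not depend on \<open>\<rho>\<close>, so the radius may vary with the slope
  \<open>t\<close>; 9 is convenient because its square root is 3.\<close>

lemma cone_distance:
  fixes z :: complex
  shows "\<exists>\<tau>. \<forall>\<rho> t. 0 \<le> \<rho> \<longrightarrow> \<bar>t\<bar> \<le> 1 \<longrightarrow>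
    norm (Complex \<rho> (\<rho> * t)) * \<bar>t - \<tau>\<bar> \<le> 9 * norm (z - Complex \<rho> (\<rho> * t))"
proof -
  have nw: "norm (Complex \<rho> (\<rho> * t)) * b \<le> 2 * (\<rho> * b)" if "0 \<le> \<rho>" "\<bar>t\<bar> \<le> 1" "0 \<le> b" for \<rho> t b :: real
  proof -
    have "norm (Complex \<rho> (\<rho> * t)) \<le> \<bar>\<rho>\<bar> + \<bar>\<rho> * t\<bar>" using cmod_le[of "Complex \<rho> (\<rho> * t)"] by simp
    also have "\<bar>\<rho> * t\<bar> \<le> \<rho>" using that by (simp add: abs_mult mult_left_le)
    finally have "norm (Complex \<rho> (\<rho> * t)) \<le> 2 * \<rho>" using that by simp
    then show ?thesis using mult_right_mono[OF _ that(3)] by (metis mult.assoc)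
  qed
  show ?thesis
  proof (cases "Re z \<noteq> 0 \<and> \<bar>Im z\<bar> \<le> 2 * \<bar>Re z\<bar>")
    case True
    define \<tau> where "\<tau> = Im z / Re z"
    have \<tau>: "Im z = \<tau> * Re z" "\<bar>\<tau>\<bar> \<le> 2" using True by (auto simp: \<tau>_def abs_divide field_simps)
    have "norm (Complex \<rho> (\<rho> * t)) * \<bar>t - \<tau>\<bar> \<le> 9 * norm (z - Complex \<rho> (\<rho> * t))"
      if "0 \<le> \<rho>" "\<bar>t\<bar> \<le> 1" for \<rho> t
    proof -
      define d where "d = z - Complex \<rho> (\<rho> * t)"
      have "\<rho> * (t - \<tau>) = \<tau> * Re d - Im d" by (simp add: d_def \<tau>(1) algebra_simps)
      then have "\<bar>\<rho> * (t - \<tau>)\<bar> \<le> \<bar>\<tau>\<bar> * \<bar>Re d\<bar> + \<bar>Im d\<bar>" by (simp add: abs_mult[symmetric])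
      moreover have "\<bar>\<tau>\<bar> * \<bar>Re d\<bar> \<le> 2 * norm d" using \<tau>(2) abs_Re_le_cmod[of d] by (intro mult_mono) auto
      moreover have "\<bar>Im d\<bar> \<le> norm d" by (rule abs_Im_le_cmod)
      ultimately have "\<rho> * \<bar>t - \<tau>\<bar> \<le> 3 * norm d" using that by (simp add: abs_mult)
      then show ?thesis using nw[OF that, of "\<bar>t - \<tau>\<bar>"] norm_ge_zero[of d] unfolding d_def[symmetric] by linarith
    qed
    then show ?thesis by blast
  next
    case False
    then have z: "2 * \<bar>Re z\<bar> \<le> \<bar>Im z\<bar>" by auto
    have "norm (Complex \<rho> (\<rho> * t)) * \<bar>t - 0\<bar> \<le> 9 * norm (z - Complex \<rho> (\<rho> * t))"
      if "0 \<le> \<rho>" "\<bar>t\<bar> \<le> 1" for \<rho> t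
    proof -
      define d where "d = z - Complex \<rho> (\<rho> * t)"
      have d: "Re d = Re z - \<rho>" "Im d = Im z - \<rho> * t" by (auto simp: d_def)
      have "\<bar>\<rho> * t\<bar> \<le> \<rho>" using that by (simp add: abs_mult mult_left_le)
      then have "\<rho> \<le> 3 * norm d"
        using abs_Re_le_cmod[of d] abs_Im_le_cmod[of d] z that unfolding d by linarith
      moreover have "\<rho> * \<bar>t\<bar> \<le> \<rho>" using that by (simp add: mult_left_le)
      ultimately show ?thesis using nw[OF that, of "\<bar>t\<bar>"] norm_ge_zero[of d] unfolding d_def[symmetric] diff_0_right by linarith
    qed
    then show ?thesis by blast
  qed
qed

text \<open>If every slope in the interval met \<open>{v < -1}\<close>, picking one such point per
  slope would give a curve of poles over a parameter set of length 1. The thinness estimate would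
  then force \<open>v 0 \<le> -1/36\<close>, however close to 0 the points are.\<close>

lemma good_ray:
  assumes v: "rsubharmonic v" and v0: "\<And>z. z \<in> cball 0 10 \<Longrightarrow> v z \<le> 0"
    and low: "- 1 / 36 < v 0" and \<alpha>: "-1 \<le> \<alpha>" "\<alpha> \<le> 0"
  obtains t where "t \<in> {\<alpha>..\<alpha> + 1}" "\<And>\<rho>. \<rho> \<in> {0..1} \<Longrightarrow> -1 \<le> v (Complex \<rho> (\<rho> * t))"
proof (rule ccontr)
  assume neg: "\<not> thesis"
  then have "\<forall>t\<in>{\<alpha>..\<alpha> + 1}. \<exists>\<rho>\<in>{0..1}. v (Complex \<rho> (\<rho> * t)) < -1"
    using that by (meson not_le)
  then obtain \<rho> where \<rho>: "\<And>t. t \<in> {\<alpha>..\<alpha> + 1} \<Longrightarrow> \<rho> t \<in> {0..1} \<and> v (Complex (\<rho> t) (\<rho> t * t)) < -1"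
    by metis
  \<comment> \<open>Since \<open>{v < -1}\<close> is open, the radius chosen for one slope also
    serves all nearby slopes.\<close>
  have "\<exists>e>0. \<forall>s\<in>cball t e. v (Complex (\<rho> t) (\<rho> t * s)) < -1" if "t \<in> {\<alpha>..\<alpha> + 1}" for t
  proof -
    have "open ((\<lambda>s. Complex (\<rho> t) (\<rho> t * s)) -` {z. v z < -1})"
      using v by (intro open_vimage) (auto simp: rsubharmonic_def intro!: continuous_intros)
    then show ?thesis
      using \<rho>[OF that] open_contains_cball[of "(\<lambda>s. Complex (\<rho> t) (\<rho> t * s)) -` {z. v z < -1}"] by fastforce
  qed
  then obtain e where e: "\<And>t. t \<in> {\<alpha>..\<alpha> + 1} \<Longrightarrow> 0 < e t \<and> (\<forall>s\<in>cball t (e t). v (Complex (\<rho> t) (\<rho> t * s)) < -1)"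
    by metis
  obtain T where T: "T \<subseteq> {\<alpha>..\<alpha> + 1}" "finite T" "{\<alpha>..\<alpha> + 1} \<subseteq> (\<Union>t\<in>T. ball t (e t))"
    by (rule compactE_image[of "{\<alpha>..\<alpha> + 1}" "{\<alpha>..\<alpha> + 1}" "\<lambda>t. ball t (e t)"])
       (use e in \<open>auto simp: compact_Icc\<close>)
  \<comment> \<open>After passing to a finite subcover, \<open>f\<close> takes only the radii of the
    chosen centres on the interval; it is measurable, and all points \<open>w s\<close> lie in the
    compact set \<open>K\<close>.\<close>
  obtain f where f: "f \<in> borel_measurable borel"
    "\<forall>s\<in>(\<Union>t\<in>T. cball t (e t)). \<exists>t\<in>T. s \<in> cball t (e t) \<and> f s = \<rho> t"
    using finite_measurable_selection[OF T(2), of "\<lambda>t. cball t (e t)" borel \<rho>] by (auto simp: borel_closed)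
  have fs: "\<exists>t\<in>T. s \<in> cball t (e t) \<and> f s = \<rho> t" if "s \<in> {\<alpha>..\<alpha> + 1}" for s
  proof -
    have "s \<in> (\<Union>t\<in>T. ball t (e t))" using that T(3) by (rule subsetD[rotated])
    then have "s \<in> (\<Union>t\<in>T. cball t (e t))" by (auto intro: less_imp_le)
    then show ?thesis by (rule f(2)[rule_format])
  qed
  have f01: "f s \<in> {0..1}" if "s \<in> {\<alpha>..\<alpha> + 1}" for s
    using fs[OF that] \<rho> T(1) by force
  define K where "K = (\<Union>t\<in>T. (\<lambda>s. Complex (\<rho> t) (\<rho> t * s)) ` cball t (e t))"
  define w where "w s = Complex (f s) (f s * s)" for s
  have vK: "v z < -1" if "z \<in> K" for z using that e T(1) unfolding K_def by blast
  have "v 0 \<le> - measure lborel {\<alpha>..\<alpha> + 1} / (12 * sqrt 9)"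
  \<comment> \<open>The radius 2 bounds \<open>norm (w t)\<close> because \<open>\<rho>\<close> and
    \<open>\<bar>t\<bar>\<close> are at most 1; it matches the disc of radius 10 in the
    hypothesis.\<close>
  proof (rule thinness_estimate[OF v, where r = 2 and K = K and w = w])
    show "compact K"
      unfolding K_def using T(2)
      by (intro compact_UN compact_continuous_image compact_cball) (auto intro!: continuous_intros)
    show "0 \<notin> K" using vK[of 0] low by auto
    show "w \<in> borel_measurable borel"
      unfolding w_def complex_eq using f(1) by (simp add: Complex_eq)
    show "{\<alpha>..\<alpha> + 1} \<subseteq> {-1..1}" using \<alpha> by auto
    show "w t \<in> K" if "t \<in> {\<alpha>..\<alpha> + 1}" for t
    proof -
      obtain x where "x \<in> T" "t \<in> cball x (e x)" "f t = \<rho> x" using fs[OF \<open>t \<in> {\<alpha>..\<alpha> + 1}\<close>] by blast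
      then show ?thesis unfolding K_def w_def by (intro UN_I[of x]) auto
    qed
    show "norm (w t) \<le> 2" if t: "t \<in> {\<alpha>..\<alpha> + 1}" for t
    proof -
      have "\<bar>f t\<bar> \<le> 1" "\<bar>t\<bar> \<le> 1" using f01[OF t] t \<alpha> by auto
      then have "\<bar>f t * t\<bar> \<le> 1" by (simp add: abs_mult mult_le_one)
      then show ?thesis using cmod_le[of "w t"] \<open>\<bar>f t\<bar> \<le> 1\<close> by (simp add: w_def)
    qed
    show "\<exists>\<tau>. \<forall>t\<in>{\<alpha>..\<alpha> + 1}. norm (w t) * \<bar>t - \<tau>\<bar> \<le> 9 * norm (z - w t)" for z
    proof -
      obtain \<tau> where \<tau>: "\<forall>\<rho> t. 0 \<le> \<rho> \<longrightarrow> \<bar>t\<bar> \<le> 1 \<longrightarrow>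
         norm (Complex \<rho> (\<rho> * t)) * \<bar>t - \<tau>\<bar> \<le> 9 * norm (z - Complex \<rho> (\<rho> * t))"
        using cone_distance by blast
      show ?thesis
      proof (intro exI[of _ \<tau>] ballI)
        fix t assume t: "t \<in> {\<alpha>..\<alpha> + 1}"
        then have "0 \<le> f t" "\<bar>t\<bar> \<le> 1" using f01[OF t] \<alpha> by auto
        then show "norm (w t) * \<bar>t - \<tau>\<bar> \<le> 9 * norm (z - w t)" unfolding w_def using \<tau> by blast
      qed
    qed
  qed (use v0 vK in auto)
  moreover have "sqrt 9 = (3::real)" by (rule real_sqrt_unique) auto
  ultimately show False using low by simp
qed

section \<open>Neighbourhoods in the pluri-fine topology\<close>

lemma circle_mean_mono:
  assumes "\<And>z. u z \<le> u' z"
  shows "circle_mean u a r \<le> circle_mean u' a r"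
  unfolding circle_mean_def
  by (intro ereal_divide_right_mono ereal_minus_mono)
     (auto intro!: nn_integral_mono mult_right_mono e2ennreal_mono assms simp: less_eq_ennreal.rep_eq[symmetric])

text \<open>The two nonnegative integrals in \<open>circle_mean\<close> are those of the positive
  and the negative part. Both are finite here, so their difference is the ordinary integral.\<close>

lemma circle_mean_ereal:
  assumes "set_integrable lborel {0..2*pi} (\<lambda>t. f (a + rcis r t))"
  shows "circle_mean (\<lambda>z. ereal (f z)) a r = ereal (integral {0..2*pi} (\<lambda>t. f (a + rcis r t)) / (2*pi))"
proof -
  define h where "h t = indicator {0..2*pi} t *\<^sub>R f (a + rcis r t)" for t
  have h: "integrable lborel h" using assms unfolding h_def[abs_def] set_integrable_def .
  have eq: "(\<integral>\<^sup>+ t \<in> {0..2*pi}. e2ennreal (ereal (f (a + rcis r t))) \<partial>lborel) = (\<integral>\<^sup>+ t. ennreal (h t) \<partial>lborel)"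
    "(\<integral>\<^sup>+ t \<in> {0..2*pi}. e2ennreal (- ereal (f (a + rcis r t))) \<partial>lborel) = (\<integral>\<^sup>+ t. ennreal (- h t) \<partial>lborel)"
    by (auto intro!: nn_integral_cong simp: h_def split: split_indicator)
  have fin: "(\<integral>\<^sup>+ t. ennreal (h t) \<partial>lborel) \<noteq> \<infinity>" "(\<integral>\<^sup>+ t. ennreal (- h t) \<partial>lborel) \<noteq> \<infinity>"
    using h by (auto simp: real_integrable_def)
  have real: "enn2ereal x = ereal (enn2real x)" if "x \<noteq> \<infinity>" for x
    using that by (cases x) auto
  have "integral {0..2*pi} (\<lambda>t. f (a + rcis r t)) = integral\<^sup>L lborel h"
    using set_borel_integral_eq_integral(2)[OF assms] unfolding set_lebesgue_integral_def h_def[abs_def] by simp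
  then show ?thesis
    unfolding circle_mean_def eq real[OF fin(1)] real[OF fin(2)]
    by (simp add: real_lebesgue_integral_def[OF h])
qed

lemma openin_plurifine_vimage:
  assumes "plurisubharmonic \<phi>" "open U"
  shows "openin plurifine_topology (\<phi> -` U)"
proof -
  have "\<phi> -` U \<in> {\<phi> -` U | \<phi> U. plurisubharmonic \<phi> \<and> open U}" using assms by blast
  then show ?thesis unfolding plurifine_topology_def by (rule topology_generated_by_Basis)
qed

text \<open>The clause on superlevel sets records pluri-fine continuity from below, so that sums and
  rescalings stay usable without returning to the generating functions. Unit circles
  \<open>cis t\<close> suffice in the mean value clause, because the radius can be absorbed into
  \<open>b\<close>. Boundedness below makes all circle integrals finite.\<close>

definition rplurisubharmonic :: "(complex ^ 'n \<Rightarrow> real) \<Rightarrow> bool" where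
  "rplurisubharmonic \<Phi> \<longleftrightarrow> (\<forall>c. open {z. \<Phi> z < c}) \<and> (\<exists>L. \<forall>z. L \<le> \<Phi> z) \<and>
    (\<forall>c. openin plurifine_topology {z. c < \<Phi> z}) \<and>
    (\<forall>a b. 2 * pi * \<Phi> a \<le> integral {0..2*pi} (\<lambda>t. \<Phi> (a + cis t *s b)))"

lemma continuous_circle_vec: "continuous_on A (\<lambda>t. a + cis t *s (b :: complex ^ 'n))"
  unfolding vector_scalar_mult_def
  by (intro continuous_intros)

lemma continuous_line_vec: "continuous_on A (\<lambda>w. a + w *s (b :: complex ^ 'n))"
  unfolding vector_scalar_mult_def
  by (intro continuous_intros)

lemma rplurisubharmonic_integrable:
  assumes "rplurisubharmonic \<Phi>"
  shows "set_integrable lborel {0..2*pi} (\<lambda>t. \<Phi> (a + cis t *s b))"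
proof -
  obtain L where "\<And>z. L \<le> \<Phi> z" "\<And>c. open {z. \<Phi> z < c}"
    using assms unfolding rplurisubharmonic_def by blast
  then show ?thesis
    using continuous_circle_vec[of UNIV a b] by (intro usc_set_integrable_circle)
qed

lemma rplurisubharmonic_line:
  assumes "rplurisubharmonic \<Phi>"
  shows "rsubharmonic (\<lambda>w. \<Phi> (a + w *s b))"
  unfolding rsubharmonic_def
proof (intro conjI allI impI)
  fix c
  have "open ((\<lambda>w. a + w *s b) -` {z. \<Phi> z < c})"
    using assms continuous_line_vec[of UNIV a b] by (intro open_vimage) (auto simp: rplurisubharmonic_def)
  then show "open {w. \<Phi> (a + w *s b) < c}" by (simp add: vimage_def)
next
  show "\<exists>L. \<forall>z. L \<le> \<Phi> (a + z *s b)" using assms unfolding rplurisubharmonic_def by blast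
next
  fix z :: complex and r :: real
  have *: "a + (z + rcis r t) *s b = (a + z *s b) + cis t *s (of_real r *s b)" for t
    by (simp add: vec_eq_iff rcis_def algebra_simps)
  show "2 * pi * \<Phi> (a + z *s b) \<le> integral {0..2*pi} (\<lambda>t. \<Phi> (a + (z + rcis r t) *s b))"
    unfolding * using assms unfolding rplurisubharmonic_def by blast
qed

lemma rplurisubharmonic_const: "rplurisubharmonic (\<lambda>_. k)"
  unfolding rplurisubharmonic_def
proof (intro conjI allI)
  fix c show "openin plurifine_topology {z. c < k}"
    using openin_topspace[of plurifine_topology] by (cases "c < k") auto
qed auto

lemma rplurisubharmonic_affine:
  assumes "rplurisubharmonic \<Phi>" "0 < k"
  shows "rplurisubharmonic (\<lambda>z. k * \<Phi> z + d)"
  unfolding rplurisubharmonic_def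
proof (intro conjI allI)
  fix c
  have *: "k * x + d < c \<longleftrightarrow> x < (c - d) / k" "c < k * x + d \<longleftrightarrow> (c - d) / k < x" for x
    using assms(2) by (auto simp: field_simps)
  show "open {z. k * \<Phi> z + d < c}" "openin plurifine_topology {z. c < k * \<Phi> z + d}"
    unfolding * using assms(1) by (auto simp: rplurisubharmonic_def)
next
  obtain L where "\<And>z. L \<le> \<Phi> z" using assms(1) by (auto simp: rplurisubharmonic_def)
  then show "\<exists>L. \<forall>z. L \<le> k * \<Phi> z + d" using assms(2) by (intro exI[of _ "k * L + d"]) auto
next
  fix a b
  have int: "(\<lambda>t. \<Phi> (a + cis t *s b)) integrable_on {0..2*pi}"
    by (rule set_borel_integral_eq_integral(1)[OF rplurisubharmonic_integrable[OF assms(1)]])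
  have "2 * pi * (k * \<Phi> a + d) = k * (2 * pi * \<Phi> a) + 2 * pi * d" by (simp add: algebra_simps)
  also have "\<dots> \<le> k * integral {0..2*pi} (\<lambda>t. \<Phi> (a + cis t *s b)) + 2 * pi * d"
    using assms by (intro add_mono mult_left_mono) (auto simp: rplurisubharmonic_def)
  also have "\<dots> = integral {0..2*pi} (\<lambda>t. k * \<Phi> (a + cis t *s b) + d)"
    using int by (subst integral_add) (auto intro: integrable_on_mult_right)
  finally show "2 * pi * (k * \<Phi> a + d) \<le> integral {0..2*pi} (\<lambda>t. k * \<Phi> (a + cis t *s b) + d)" .
qed

lemma rplurisubharmonic_add:
  assumes "rplurisubharmonic \<Phi>" "rplurisubharmonic \<Psi>"
  shows "rplurisubharmonic (\<lambda>z. \<Phi> z + \<Psi> z)"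
  unfolding rplurisubharmonic_def
proof (intro conjI allI)
  fix c
  have "{z. \<Phi> z + \<Psi> z < c} = (\<Union>q. {z. \<Phi> z < q} \<inter> {z. \<Psi> z < c - q})"
  proof (intro equalityI subsetI)
    fix z assume "z \<in> {z. \<Phi> z + \<Psi> z < c}"
    then show "z \<in> (\<Union>q. {z. \<Phi> z < q} \<inter> {z. \<Psi> z < c - q})"
      by (intro UN_I[of "(\<Phi> z + (c - \<Psi> z)) / 2"]) (auto simp: field_simps)
  qed auto
  then show "open {z. \<Phi> z + \<Psi> z < c}"
    using assms unfolding rplurisubharmonic_def by (simp only:) (intro open_UN ballI open_Int; blast)
  have "{z. c < \<Phi> z + \<Psi> z} = \<Union> (range (\<lambda>q. {z. q < \<Phi> z} \<inter> {z. c - q < \<Psi> z}))"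
  proof (intro equalityI subsetI)
    fix z assume "z \<in> {z. c < \<Phi> z + \<Psi> z}"
    then show "z \<in> \<Union> (range (\<lambda>q. {z. q < \<Phi> z} \<inter> {z. c - q < \<Psi> z}))"
      by (intro UN_I[of "(\<Phi> z + (c - \<Psi> z)) / 2"]) (auto simp: field_simps)
  qed auto
  then show "openin plurifine_topology {z. c < \<Phi> z + \<Psi> z}"
    using assms by (auto simp: rplurisubharmonic_def intro!: openin_Union openin_Int)
next
  obtain L M where "\<And>z. L \<le> \<Phi> z" "\<And>z. M \<le> \<Psi> z" using assms by (auto simp: rplurisubharmonic_def)
  then show "\<exists>L. \<forall>z. L \<le> \<Phi> z + \<Psi> z" by (intro exI[of _ "L + M"]) (auto intro: add_mono)
next
  fix a b
  have int: "(\<lambda>t. \<Phi> (a + cis t *s b)) integrable_on {0..2*pi}" "(\<lambda>t. \<Psi> (a + cis t *s b)) integrable_on {0..2*pi}"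
    using assms by (auto intro: set_borel_integral_eq_integral(1)[OF rplurisubharmonic_integrable])
  have "2 * pi * \<Phi> a \<le> integral {0..2*pi} (\<lambda>t. \<Phi> (a + cis t *s b))"
    "2 * pi * \<Psi> a \<le> integral {0..2*pi} (\<lambda>t. \<Psi> (a + cis t *s b))"
    using assms by (auto simp: rplurisubharmonic_def)
  then show "2 * pi * (\<Phi> a + \<Psi> a) \<le> integral {0..2*pi} (\<lambda>t. \<Phi> (a + cis t *s b) + \<Psi> (a + cis t *s b))"
    unfolding integral_add[OF int] by (simp only: distrib_left)
qed

text \<open>The circle mean of the maximum dominates \<open>\<phi> a\<close>, by monotonicity of
  \<open>circle_mean\<close>, and also the constant \<open>L\<close>, hence the larger of the
  two.\<close>

lemma rplurisubharmonic_truncate: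
  fixes \<phi> :: "complex ^ 'n \<Rightarrow> ereal"
  assumes \<phi>: "plurisubharmonic \<phi>"
  shows "rplurisubharmonic (\<lambda>z. real_of_ereal (max (\<phi> z) (ereal L)))" (is "rplurisubharmonic ?\<Phi>")
proof -
  have fin: "\<phi> z < \<infinity>" for z using \<phi> by (simp add: plurisubharmonic_def)
  have \<Phi>: "ereal (?\<Phi> z) = max (\<phi> z) (ereal L)" for z
    using fin[of z] by (cases "\<phi> z") (auto simp: max_def)
  have lt: "?\<Phi> z < c \<longleftrightarrow> \<phi> z < ereal c \<and> L < c" for z c
    by (subst less_ereal.simps(1)[symmetric], subst \<Phi>) auto
  have gt: "c < ?\<Phi> z \<longleftrightarrow> ereal c < \<phi> z \<or> c < L" for z c
    by (subst less_ereal.simps(1)[symmetric], subst \<Phi>) (auto simp: less_max_iff_disj)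
  have L: "L \<le> ?\<Phi> z" for z
    by (subst ereal_less_eq(3)[symmetric], subst \<Phi>) auto
  have uscop: "open {z. ?\<Phi> z < c}" for c
  proof (cases "L < c")
    case True
    then show ?thesis using \<phi> unfolding lt by (simp add: plurisubharmonic_def usc_def)
  qed (simp add: lt)
  show ?thesis
    unfolding rplurisubharmonic_def
  proof (intro conjI allI uscop exI[of _ L] L)
    fix c
    have "openin plurifine_topology (\<phi> -` {ereal c<..})"
      using \<phi> by (intro openin_plurifine_vimage) auto
    then show "openin plurifine_topology {z. c < ?\<Phi> z}"
      unfolding gt using openin_topspace[of "plurifine_topology :: (complex ^ 'n) topology"]
      by (cases "c < L") (auto simp: vimage_def greaterThan_def)
  next
    fix a b :: "complex ^ 'n"
    define h where "h w = ?\<Phi> (a + w *s b)" for w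
    let ?I = "integral {0..2*pi} (\<lambda>t. ?\<Phi> (a + cis t *s b))"
    have int: "set_integrable lborel {0..2*pi} (\<lambda>t. ?\<Phi> (a + cis t *s b))"
      by (rule usc_set_integrable_circle[OF uscop L continuous_circle_vec])
    have "\<phi> (a + 0 *s b) \<le> circle_mean (\<lambda>w. \<phi> (a + w *s b)) 0 1"
      using \<phi> unfolding plurisubharmonic_def subharmonic_def by (metis zero_less_one)
    also have "\<dots> \<le> circle_mean (\<lambda>w. ereal (h w)) 0 1"
      by (rule circle_mean_mono) (simp add: h_def \<Phi>)
    also have "\<dots> = ereal (?I / (2*pi))"
      using int by (subst circle_mean_ereal) (simp_all add: h_def rcis_def)
    finally have 1: "\<phi> a \<le> ereal (?I / (2*pi))" by simp
    have "integral {0..2*pi} (\<lambda>t. L) \<le> ?I"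
      using L set_borel_integral_eq_integral(1)[OF int] by (intro integral_le) auto
    then have "L \<le> ?I / (2*pi)" by (simp add: field_simps)
    with 1 have "ereal (?\<Phi> a) \<le> ereal (?I / (2*pi))" unfolding \<Phi> by simp
    then show "2 * pi * ?\<Phi> a \<le> ?I" by (simp add: field_simps)
  qed
qed

section \<open>The norm and pluri-fine neighbourhoods\<close>

text \<open>By the Cauchy-Schwarz inequality \<open>norm p * norm (p + cis t *s q)\<close> is at
  least the real inner product of \<open>p\<close> with \<open>p + cis t *s q\<close>. The latter is
  a trigonometric polynomial in \<open>t\<close> with mean \<open>(norm p)^2\<close>.\<close>

lemma norm_circle_mean:
  fixes p q :: "complex ^ 'n"
  shows "2 * pi * norm p \<le> integral {0..2*pi} (\<lambda>t. norm (p + cis t *s q))"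
proof (cases "p = 0")
  case True
  then show ?thesis
    by (simp add: integral_nonneg integrable_continuous_interval continuous_on_norm[OF continuous_circle_vec[of _ 0 q, simplified]])
next
  case False
  have split: "cis t *s q = cos t *\<^sub>R q + sin t *\<^sub>R (\<i> *s q)" for t
    by (simp add: vec_eq_iff complex_eq_iff)
  have "((\<lambda>t. (norm p)^2 + inner p q * cos t + inner p (\<i> *s q) * sin t) has_integral 2 * pi * (norm p)^2) {0..2*pi}"
    by (rule circle_trig_has_integral)
  moreover have "(\<lambda>t. norm p * norm (p + cis t *s q)) integrable_on {0..2*pi}"
    by (intro integrable_continuous_interval continuous_intros continuous_circle_vec)
  then have "((\<lambda>t. norm p * norm (p + cis t *s q)) has_integral
     norm p * integral {0..2*pi} (\<lambda>t. norm (p + cis t *s q))) {0..2*pi}"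
    using integral_mult_right integrable_integral by metis
  moreover have "(norm p)^2 + inner p q * cos t + inner p (\<i> *s q) * sin t \<le> norm p * norm (p + cis t *s q)" for t
  proof -
    have "(norm p)^2 + inner p q * cos t + inner p (\<i> *s q) * sin t = inner p (p + cis t *s q)"
      by (simp add: split inner_add_right power2_norm_eq_inner)
    then show ?thesis using norm_cauchy_schwarz by metis
  qed
  ultimately have "2 * pi * (norm p)^2 \<le> norm p * integral {0..2*pi} (\<lambda>t. norm (p + cis t *s q))"
    by (rule has_integral_le)
  then show ?thesis using False by (simp add: power2_eq_square)
qed

text \<open>Its sublevel sets are the Euclidean balls, which are therefore pluri-finely
  open.\<close>

lemma plurisubharmonic_norm: "plurisubharmonic (\<lambda>z :: complex ^ 'n. ereal (norm (z - p)))"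
proof -
  have usc: "usc (\<lambda>x. ereal (f x))" if "continuous_on UNIV f" for f :: "'b::topological_space \<Rightarrow> real"
    unfolding usc_def using that by (intro allI open_Collect_less continuous_intros)
  show ?thesis
    unfolding plurisubharmonic_def subharmonic_def
  proof (intro conjI allI impI usc)
    fix a b :: "complex ^ 'n" and w :: complex and r :: real
    define f where "f w = norm (a + w *s b - p)" for w
    have *: "a + (w + rcis r t) *s b - p = (a + w *s b - p) + cis t *s (of_real r *s b)" for t
      by (simp add: vec_eq_iff rcis_def algebra_simps)
    have cont: "continuous_on A (\<lambda>t. f (w + rcis r t))" for A
      unfolding f_def * by (intro continuous_intros continuous_circle_vec)
    have "set_integrable lborel {0..2*pi} (\<lambda>t. f (w + rcis r t))"
      by (intro borel_integrable_atLeastAtMost' cont)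
    then have "circle_mean (\<lambda>w. ereal (f w)) w r = ereal (integral {0..2*pi} (\<lambda>t. f (w + rcis r t)) / (2*pi))"
      by (rule circle_mean_ereal)
    moreover have "f w \<le> integral {0..2*pi} (\<lambda>t. f (w + rcis r t)) / (2*pi)"
      using norm_circle_mean[of "a + w *s b - p" "of_real r *s b"] unfolding f_def *
      by (subst pos_le_divide_eq) (simp_all only: mult.commute, simp)
    ultimately show "ereal (norm (a + w *s b - p)) \<le> circle_mean (\<lambda>w. ereal (norm (a + w *s b - p))) w r"
      by (simp add: f_def)
  qed (auto intro!: continuous_intros continuous_line_vec)
qed

lemma openin_plurifine_ball: "openin plurifine_topology (ball (a :: complex ^ 'n) r)"
proof -
  have "openin plurifine_topology ((\<lambda>z :: complex ^ 'n. ereal (norm (z - a))) -` {..<ereal r})"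
    by (intro openin_plurifine_vimage plurisubharmonic_norm open_lessThan)
  moreover have "(\<lambda>z. ereal (norm (z - a))) -` {..<ereal r} = ball a r"
    by (auto simp: dist_norm norm_minus_commute)
  ultimately show ?thesis by simp
qed

text \<open>By induction on the generation of the topology. For an intersection the two functions
  are added: both are nonpositive near \<open>a\<close>, so a sum of at least -1 forces each summand
  to be at least -1. For a generating set, upper semicontinuity bounds \<open>\<phi>\<close> from
  above on a ball, and an affine rescaling does the rest.\<close>

lemma plurifine_neighbourhood:
  fixes \<Omega> :: "(complex ^ 'n) set"
  assumes "openin plurifine_topology \<Omega>" "a \<in> \<Omega>" "0 < \<eta>"
  obtains \<Phi> R where "rplurisubharmonic \<Phi>" "0 < R" "\<And>z. z \<in> ball a R \<Longrightarrow> \<Phi> z \<le> 0" "- \<eta> < \<Phi> a"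
    "\<And>z. z \<in> ball a R \<Longrightarrow> -1 \<le> \<Phi> z \<Longrightarrow> z \<in> \<Omega>"
proof -
  \<comment> \<open>The induction must leave \<open>\<eta>\<close> free, since the case of an
    intersection uses \<open>\<eta> / 2\<close> for each set.\<close>
  define P where "P \<eta> \<Omega> \<longleftrightarrow> (\<exists>\<Phi> R. rplurisubharmonic \<Phi> \<and> 0 < R \<and> (\<forall>z\<in>ball a R. \<Phi> z \<le> 0) \<and> - \<eta> < \<Phi> a \<and>
    (\<forall>z\<in>ball a R. -1 \<le> \<Phi> z \<longrightarrow> z \<in> \<Omega>))" for \<eta> :: real and \<Omega> :: "(complex ^ 'n) set"
  have "generate_topology_on {\<phi> -` U | (\<phi> :: complex ^ 'n \<Rightarrow> ereal) U. plurisubharmonic \<phi> \<and> open U} \<Omega>"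
    using assms(1) unfolding plurifine_topology_def by (rule openin_topology_generated_by)
  then have "a \<in> \<Omega> \<Longrightarrow> 0 < \<eta> \<Longrightarrow> P \<eta> \<Omega>"
  proof (induction arbitrary: \<eta> rule: generate_topology_on.induct)
    case Empty
    then show ?case by simp
  next
    case (Int A B)
    then have "P (\<eta>/2) A" "P (\<eta>/2) B" by auto
    then obtain \<Phi> R \<Psi> S where
      1: "rplurisubharmonic \<Phi>" "0 < R" "\<forall>z\<in>ball a R. \<Phi> z \<le> 0" "- (\<eta>/2) < \<Phi> a" "\<forall>z\<in>ball a R. -1 \<le> \<Phi> z \<longrightarrow> z \<in> A" and
      2: "rplurisubharmonic \<Psi>" "0 < S" "\<forall>z\<in>ball a S. \<Psi> z \<le> 0" "- (\<eta>/2) < \<Psi> a" "\<forall>z\<in>ball a S. -1 \<le> \<Psi> z \<longrightarrow> z \<in> B"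
      unfolding P_def by blast
    show ?case
      unfolding P_def
    proof (intro exI[of _ "\<lambda>z. \<Phi> z + \<Psi> z"] exI[of _ "min R S"] conjI ballI impI)
      show "rplurisubharmonic (\<lambda>z. \<Phi> z + \<Psi> z)" using 1(1) 2(1) by (rule rplurisubharmonic_add)
      fix z assume z: "z \<in> ball a (min R S)"
      then show le: "\<Phi> z + \<Psi> z \<le> 0" using 1 2 by (simp add: add_nonpos_nonpos)
      assume "-1 \<le> \<Phi> z + \<Psi> z"
      moreover have "\<Phi> z \<le> 0" "\<Psi> z \<le> 0" using z 1 2 by auto
      ultimately have "-1 \<le> \<Phi> z" "-1 \<le> \<Psi> z" by linarith+
      then show "z \<in> A \<inter> B" using z 1 2 by auto
    qed (use 1 2 in auto)
  next
    case (UN K)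
    then obtain k where k: "k \<in> K" "a \<in> k" by blast
    then have "P \<eta> k" using UN by blast
    then show ?case unfolding P_def using k(1) by blast
  next
    case (Basis s)
    then obtain \<phi> :: "complex ^ 'n \<Rightarrow> ereal" and U where s: "s = \<phi> -` U" and \<phi>: "plurisubharmonic \<phi>" and U: "open U"
      by blast
    have aU: "\<phi> a \<in> U" using Basis s by simp
    have usc: "open {z. \<phi> z < c}" for c using \<phi> by (simp add: plurisubharmonic_def usc_def)
    have ball: "\<exists>R>0. \<forall>z\<in>ball a R. \<phi> z < c" if "\<phi> a < c" for c
      using openE[OF usc, of a c] that by (metis (mono_tags) mem_Collect_eq subsetD)
    show ?case
    proof (cases "\<phi> a")
      case PInf
      then show ?thesis using \<phi> by (simp add: plurisubharmonic_def)
    next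
      case MInf
      then obtain c where c: "{..<ereal c} \<subseteq> U" using open_MInfty[OF U] aU by auto
      \<comment> \<open>At a point with value \<open>-\<infinity>\<close> semicontinuity alone puts
        a Euclidean ball into the set, so the constant 0 serves as \<open>\<Phi>\<close>.\<close>
      obtain R where "0 < R" "\<forall>z\<in>ball a R. \<phi> z < ereal c" using ball[of "ereal c"] MInf by auto
      then show ?thesis
        unfolding P_def s using rplurisubharmonic_const[of 0] c Basis.prems
        by (intro exI[of _ "\<lambda>_. 0"] exI[of _ R]) auto
    next
      case (real x)
      obtain d where d: "0 < d" "\<And>y. y \<in> cball x d \<Longrightarrow> ereal y \<in> U"
      proof -
        have "open (ereal -` U)" using U by (rule open_ereal_vimage)
        then show ?thesis using that aU real open_contains_cball[of "ereal -` U"] by force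
      qed
      \<comment> \<open>\<open>e \<le> d\<close> keeps the values below \<open>x + e\<close> inside
        the window around \<open>x\<close>; \<open>e < \<eta> * d\<close> makes
        \<open>e / (d + e)\<close>, which is \<open>- \<Phi> a\<close> below, smaller than
        \<open>\<eta>\<close>.\<close>
      define e where "e = min d (\<eta> * d / 2)"
      have e: "0 < e" "e \<le> d" "e < \<eta> * d" using d Basis.prems by (auto simp: e_def min_def)
      obtain R where R: "0 < R" "\<forall>z\<in>ball a R. \<phi> z < ereal (x + e)" using ball[of "ereal (x + e)"] real e by auto
      \<comment> \<open>The truncation level lies below \<open>x - d\<close>, so
        \<open>\<Theta>\<close> and \<open>\<phi>\<close> agree wherever
        \<open>\<Theta> z \<ge> x - d\<close>.\<close>
      define \<Theta> where "\<Theta> z = real_of_ereal (max (\<phi> z) (ereal (x - 2 * d)))" for z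
      have \<Theta>: "ereal (\<Theta> z) = max (\<phi> z) (ereal (x - 2 * d))" for z
      proof -
        have "\<phi> z < \<infinity>" using \<phi> by (simp add: plurisubharmonic_def)
        then show ?thesis by (cases "\<phi> z") (auto simp: max_def \<Theta>_def)
      qed
      have \<Theta>R: "\<Theta> z < x + e" if "z \<in> ball a R" for z
      proof -
        have "ereal (\<Theta> z) < ereal (x + e)" unfolding \<Theta> using R that d e by auto
        then show ?thesis by simp
      qed
      have \<Theta>a: "\<Theta> a = x" using \<Theta>[of a] real d by (auto simp: max_def split: if_splits)
      \<comment> \<open>The affine map sends \<open>x + e\<close> to 0 and \<open>x - d\<close> to
        -1.\<close>
      define \<Phi> where "\<Phi> z = inverse (d + e) * \<Theta> z + (- (inverse (d + e) * (x + e)))" for z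
      have \<Phi>: "\<Phi> z = (\<Theta> z - (x + e)) / (d + e)" for z by (simp add: \<Phi>_def divide_inverse algebra_simps)
      show ?thesis
        unfolding P_def
      proof (intro exI[of _ \<Phi>] exI[of _ R] conjI ballI impI R(1))
        show "rplurisubharmonic \<Phi>"
          unfolding \<Phi>_def \<Theta>_def using d e \<phi> by (intro rplurisubharmonic_affine rplurisubharmonic_truncate) auto
        have "\<eta> * d < \<eta> * (d + e)" using Basis.prems e by simp
        then show "- \<eta> < \<Phi> a" unfolding \<Phi> \<Theta>a using d e by (simp add: field_simps)
        fix z assume z: "z \<in> ball a R"
        then show "\<Phi> z \<le> 0" unfolding \<Phi> using \<Theta>R[OF z] d e by (simp add: divide_nonpos_pos)
        assume "-1 \<le> \<Phi> z"
        then have "x - d \<le> \<Theta> z" unfolding \<Phi> using d e by (simp add: field_simps)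
        then have "ereal (\<Theta> z) \<noteq> ereal (x - 2 * d)" using d by auto
        then have eq: "\<phi> z = ereal (\<Theta> z)" using \<Theta>[of z] by (auto simp: max_def split: if_splits)
        have "\<Theta> z \<in> cball x d" using \<open>x - d \<le> \<Theta> z\<close> \<Theta>R[OF z] e by (auto simp: dist_real_def)
        then show "z \<in> s" unfolding s using d(2) eq by simp
      qed
    qed
  qed
  then have "P \<eta> \<Omega>" using assms by blast
  then show ?thesis using that unfolding P_def by blast
qed

section \<open>Segments are connected\<close>

lemma norm_vector_scalar_mult: "norm (c *s (b :: complex ^ 'n)) = norm c * norm b"
  by (simp add: norm_vec_def norm_mult L2_set_right_distrib)

text \<open>On short segments issuing from one of its points, a pluri-finely open set misses at most
  a quarter of the length. The missed set need not be measurable, hence the Borel superset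
  \<open>B\<close>.\<close>

lemma plurifine_line_density:
  fixes p b :: "complex ^ 'n" and x :: real
  defines "\<gamma> \<equiv> \<lambda>t. p + of_real t *s b"
  assumes E: "openin plurifine_topology E" "\<gamma> x \<in> E"
  obtains d where "0 < d"
    "\<And>y. y \<noteq> x \<Longrightarrow> \<bar>y - x\<bar> < d \<Longrightarrow>
      \<exists>B\<in>sets borel. {t \<in> closed_segment x y. \<gamma> t \<notin> E} \<subseteq> B \<and> B \<subseteq> closed_segment x y \<and> measure lborel B \<le> \<bar>y - x\<bar> / 4"
proof -
  \<comment> \<open>The value \<open>1/48\<close> turns the bound \<open>-12 * v 0\<close> of
    \<open>line_thinness\<close> into \<open>1/4\<close>.\<close>
  obtain \<Phi> R where \<Phi>: "rplurisubharmonic \<Phi>" and R: "0 < R" and \<Phi>0: "\<And>z. z \<in> ball (\<gamma> x) R \<Longrightarrow> \<Phi> z \<le> 0"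
    and \<Phi>x: "- (1/48) < \<Phi> (\<gamma> x)" and \<Phi>E: "\<And>z. z \<in> ball (\<gamma> x) R \<Longrightarrow> -1 \<le> \<Phi> z \<Longrightarrow> z \<in> E"
    using plurifine_neighbourhood[OF E, of "1/48"] by auto
  \<comment> \<open>This makes \<open>5 * h * norm b < R\<close> for \<open>h < d\<close>, as
    \<open>line_thinness\<close> needs the disc of radius \<open>5 * h\<close>; the summand 1 covers
    \<open>b = 0\<close>.\<close>
  define d where "d = R / (5 * norm b + 1)"
  have d: "0 < d" using R by (simp add: d_def add_nonneg_pos)
  have dR: "5 * h * norm b < R" if "h < d" "0 < h" for h
  proof -
    have "5 * h * norm b \<le> h * (5 * norm b + 1)" using that by (simp add: algebra_simps)
    also have "\<dots> < d * (5 * norm b + 1)" using that by (intro mult_strict_right_mono) (auto simp: add_nonneg_pos)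
    also have "\<dots> = R" using add_nonneg_pos[of "5 * norm b" 1] by (simp add: d_def)
    finally show ?thesis .
  qed
  show ?thesis
  proof (rule that[OF d])
    fix y assume y: "y \<noteq> x" "\<bar>y - x\<bar> < d"
    define h where "h = \<bar>y - x\<bar>"
    have h: "0 < h" "h < d" using y by (auto simp: h_def)
    \<comment> \<open>The sign treats \<open>y\<close> on either side of \<open>x\<close> alike: the
      segment is always the image of positive parameters \<open>h * s\<close>.\<close>
    define \<sigma> where "\<sigma> = sgn (y - x)"
    have \<sigma>: "\<bar>\<sigma>\<bar> = 1" "\<sigma> * h = y - x" using y by (auto simp: \<sigma>_def h_def sgn_if)
    define v where "v w = \<Phi> (\<gamma> x + w *s (of_real \<sigma> *s b))" for w
    have v: "rsubharmonic v" unfolding v_def by (rule rplurisubharmonic_line[OF \<Phi>])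
    have ball: "\<gamma> x + w *s (of_real \<sigma> *s b) \<in> ball (\<gamma> x) R" if "norm w \<le> 5 * h" for w
    proof -
      have "norm w * norm b \<le> 5 * h * norm b" using that by (intro mult_right_mono) auto
      then show ?thesis using dR[OF h(2,1)] by (simp add: dist_norm norm_vector_scalar_mult norm_mult \<sigma>)
    qed
    define G where "G = {s \<in> {0..1}. v (of_real (h * s)) < -1}"
    have "measure lborel G \<le> -12 * v 0"
      unfolding G_def
    proof (rule line_thinness[OF v h(1)])
      show "v z \<le> 0" if "z \<in> cball 0 (5 * h)" for z
        unfolding v_def using that by (intro \<Phi>0 ball) auto
      show "-1 \<le> v 0" using \<Phi>x by (simp add: v_def)
    qed
    then have G4: "measure lborel G \<le> 1/4" using \<Phi>x by (simp add: v_def)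
    have vb: "v \<in> borel_measurable borel"
      using v by (intro usc_borel_measurable) (simp add: rsubharmonic_def)
    have "(\<lambda>s. v (of_real (h * s))) \<in> borel_measurable borel"
      by (rule measurable_compose[OF _ vb]) (intro borel_measurable_continuous_onI continuous_intros)
    then have Gb: "G \<in> sets borel" unfolding G_def by measurable
    define B where "B = {t. (t - x) / (y - x) \<in> G}"
    have Bb: "B \<in> sets borel"
    proof -
      have "(\<lambda>t. (t - x) / (y - x)) \<in> borel_measurable borel" by measurable
      from measurable_sets[OF this Gb] show ?thesis by (simp add: B_def vimage_def)
    qed
    have img: "B = (\<lambda>s. x + (y - x) * s) ` G"
    proof (intro equalityI subsetI)
      fix t assume "t \<in> B"
      then show "t \<in> (\<lambda>s. x + (y - x) * s) ` G" using y
        by (intro image_eqI[of _ _ "(t - x) / (y - x)"]) (auto simp: B_def)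
    qed (use y in \<open>auto simp: B_def\<close>)
    have \<gamma>v: "\<Phi> (\<gamma> (x + (y - x) * s)) = v (of_real (h * s))" for s
    proof -
      have "\<gamma> (x + (y - x) * s) = \<gamma> x + of_real (h * s) *s (of_real \<sigma> *s b)"
        unfolding \<gamma>_def \<sigma>(2)[symmetric] by (simp add: vec_eq_iff algebra_simps)
      then show ?thesis by (simp add: v_def)
    qed
    show "\<exists>B\<in>sets borel. {t \<in> closed_segment x y. \<gamma> t \<notin> E} \<subseteq> B \<and> B \<subseteq> closed_segment x y \<and> measure lborel B \<le> \<bar>y - x\<bar> / 4"
    proof (intro bexI[of _ B] conjI Bb)
      show "B \<subseteq> closed_segment x y"
      proof
        fix t assume "t \<in> B"
        then obtain s where "0 \<le> s" "s \<le> 1" "t = x + (y - x) * s" unfolding img G_def by auto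
        then show "t \<in> closed_segment x y"
          unfolding closed_segment_def by (intro CollectI exI[of _ s]) (auto simp: algebra_simps)
      qed
      show "{t \<in> closed_segment x y. \<gamma> t \<notin> E} \<subseteq> B"
      proof
        fix t assume t: "t \<in> {t \<in> closed_segment x y. \<gamma> t \<notin> E}"
        then obtain s where s: "0 \<le> s" "s \<le> 1" "t = x + (y - x) * s"
          by (auto simp: closed_segment_def algebra_simps)
        have eq: "\<gamma> t = \<gamma> x + of_real (h * s) *s (of_real \<sigma> *s b)"
          unfolding s(3) \<gamma>_def \<sigma>(2)[symmetric] by (simp add: vec_eq_iff algebra_simps)
        have "\<gamma> t \<in> ball (\<gamma> x) R"
          unfolding eq using s h mult_left_le[of s h] by (intro ball) (simp add: norm_mult)
        then have "\<Phi> (\<gamma> t) < -1" using \<Phi>E t by force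
        then have "s \<in> G" using s \<gamma>v[of s] by (simp add: G_def)
        then show "t \<in> B" unfolding img using s by auto
      qed
      have "measure lebesgue B = \<bar>y - x\<bar> * measure lebesgue G"
        using measure_lebesgue_affine[of "y - x" x G] by (simp add: img add.commute)
      then show "measure lborel B \<le> \<bar>y - x\<bar> / 4"
        using G4 Bb Gb mult_left_mono[OF G4, of "\<bar>y - x\<bar>"] by simp
    qed
  qed
qed

text \<open>Let \<open>F t\<close> measure the part of the hull up to \<open>t\<close>. To the right
  of a point of \<open>E1\<close> its difference quotients are eventually at least
  \<open>3/4\<close>, to the left of a point of \<open>E2\<close> at most \<open>1/4\<close>. So
  \<open>F t - t / 2\<close> has no place for a maximum on \<open>{t1..t2}\<close>: it can be
  increased by moving right from the first kind of point and left from the second.\<close>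

lemma no_plurifine_split_of_segment:
  fixes p b :: "complex ^ 'n" and t1 t2 :: real
  defines "\<gamma> \<equiv> \<lambda>t. p + of_real t *s b"
  assumes E: "openin plurifine_topology E1" "openin plurifine_topology E2"
    and cover: "\<And>t. t \<in> {0..1} \<Longrightarrow> \<gamma> t \<in> E1 \<union> E2"
    and disj: "\<And>t. t \<in> {0..1} \<Longrightarrow> \<not> (\<gamma> t \<in> E1 \<and> \<gamma> t \<in> E2)"
    and t: "0 \<le> t1" "t1 < t2" "t2 \<le> 1" and t1: "\<gamma> t1 \<in> E1" and t2: "\<gamma> t2 \<in> E2"
  shows False
proof -
  \<comment> \<open>\<open>T\<close> need not be measurable, so it is replaced by a Borel hull \<open>H\<close> of the same outer measure.\<close>
  define T where "T = {t \<in> {0..1}. \<gamma> t \<in> E1}"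
  obtain H where H: "H \<in> sets lborel" "T \<subseteq> H" "outer_measure_of lborel T = emeasure lborel H"
    using outer_measure_of_attain[of T lborel] by auto
  have "emeasure lborel H \<le> outer_measure_of lborel {0..1::real}"
    unfolding H(3)[symmetric] by (rule outer_measure_of_mono) (auto simp: T_def)
  then have Hfin: "emeasure lborel H < \<infinity>" by (simp add: le_less_trans)
  have [measurable]: "H \<in> sets borel" using H by simp
  have Hmin: "emeasure lborel H \<le> emeasure lborel S" if "S \<in> sets lborel" "T \<subseteq> S" for S
    using outer_measure_of_mono[OF that(2), of lborel] that(1) H(3) by simp
  have fm: "A \<in> fmeasurable lborel" if "A \<in> sets borel" "A \<subseteq> {x..y}" for A and x y :: real
  proof (rule fmeasurableI2[OF _ that(2)])
    show "{x..y} \<in> fmeasurable lborel" by (rule fmeasurableI) (simp_all add: emeasure_lborel_Icc_eq)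
    show "A \<in> sets lborel" using that(1) by simp
  qed
  define F where "F t = measure lborel (H \<inter> {0..t})" for t
  define \<mu> where "\<mu> x y = measure lborel (H \<inter> {x<..y})" for x y
  have F\<mu>: "F y = F x + \<mu> x y" if "0 \<le> x" "x \<le> y" for x y
  proof -
    have "H \<inter> {0..y} = (H \<inter> {0..x}) \<union> (H \<inter> {x<..y})" using that by auto
    moreover have "H \<inter> {0..x} \<in> fmeasurable lborel" by (rule fm[of _ 0 x]) auto
    moreover have "H \<inter> {x<..y} \<in> fmeasurable lborel" by (rule fm[of _ x y]) auto
    ultimately have "measure lborel (H \<inter> {0..y}) = measure lborel (H \<inter> {0..x}) + measure lborel (H \<inter> {x<..y})"
      by (auto simp: fmeasurable_def intro!: measure_Union)
    then show ?thesis unfolding F_def \<mu>_def by simp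
  qed
  have \<mu>0: "0 \<le> \<mu> x y" for x y by (simp add: \<mu>_def)
  have \<mu>le: "\<mu> x y \<le> y - x" if "x \<le> y" for x y
  proof -
    have "\<mu> x y \<le> measure lborel {x<..y}"
      unfolding \<mu>_def by (intro measure_mono_fmeasurable) (auto intro!: fm[of _ x y])
    then show ?thesis using that by simp
  qed
  \<comment> \<open>Off \<open>B\<close> every point of the interval lies in \<open>T\<close>, so
    the hull contains all but at most a quarter of it.\<close>
  have low: "3/4 * (y - x) \<le> \<mu> x y"
    if xy: "0 \<le> x" "x \<le> y" "y \<le> 1" and B: "B \<in> sets borel" "B \<subseteq> {x..y}" "{t\<in>{x..y}. \<gamma> t \<notin> E1} \<subseteq> B" "measure lborel B \<le> (y - x) / 4"
    for x y B
  proof -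
    have "{x<..y} \<subseteq> (H \<inter> {x<..y}) \<union> B"
    proof
      fix t assume t: "t \<in> {x<..y}"
      show "t \<in> (H \<inter> {x<..y}) \<union> B"
      proof (cases "\<gamma> t \<in> E1")
        case True
        then have "t \<in> T" using t xy by (simp add: T_def)
        then show ?thesis using t H(2) by blast
      next
        case False
        then have "t \<in> {t\<in>{x..y}. \<gamma> t \<notin> E1}" using t by simp
        then show ?thesis using B(3) by blast
      qed
    qed
    then have "measure lborel {x<..y} \<le> measure lborel ((H \<inter> {x<..y}) \<union> B)"
      using B(1,2) by (intro measure_mono_fmeasurable) (auto intro!: fm[of _ x y])
    also have "\<dots> \<le> \<mu> x y + measure lborel B"
      unfolding \<mu>_def using B(1) by (intro measure_Un_le) auto
    finally show ?thesis using B(4) xy by simp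
  qed
  have up: "\<mu> x y \<le> (y - x) / 4"
    if xy: "0 \<le> x" "x \<le> y" "y \<le> 1" and B: "B \<in> sets borel" "B \<subseteq> {x..y}" "{t\<in>{x..y}. \<gamma> t \<notin> E2} \<subseteq> B" "measure lborel B \<le> (y - x) / 4"
    for x y B
  proof -
    \<comment> \<open>\<open>N\<close> contains no point of \<open>T\<close>, so
      \<open>H - N\<close> still covers \<open>T\<close>; minimality of the hull makes
      \<open>N\<close> null, and only \<open>B\<close> contributes to
      \<open>\<mu> x y\<close>.\<close>
    define N where "N = H \<inter> ({x<..y} - B)"
    have Nb: "N \<in> sets borel" using B(1) by (simp add: N_def)
    have "T \<subseteq> H - N"
    proof
      fix t assume t: "t \<in> T"
      then have "\<gamma> t \<notin> E2" using disj by (auto simp: T_def)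
      then have "t \<in> {x<..y} \<Longrightarrow> t \<in> B" using B(3) by auto
      then show "t \<in> H - N" using t H(2) by (auto simp: N_def)
    qed
    then have "emeasure lborel H \<le> emeasure lborel (H - N)" using Nb by (intro Hmin) auto
    moreover have "emeasure lborel (H - N) + emeasure lborel N = emeasure lborel H"
      using Nb by (subst plus_emeasure) (auto simp: N_def intro!: arg_cong[where f = "emeasure lborel"])
    moreover have "emeasure lborel (H - N) < \<infinity>"
      using Hfin emeasure_mono[of "H - N" H lborel] by (auto simp: le_less_trans)
    ultimately have "emeasure lborel N = 0"
      by (metis add.right_neutral ennreal_add_left_cancel_le infinity_ennreal_def le_zero_eq less_irrefl)
    then have "measure lborel N = 0" by (simp add: measure_def)
    moreover have "\<mu> x y \<le> measure lborel (N \<union> B)"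
      unfolding \<mu>_def N_def using B(1,2) by (intro measure_mono_fmeasurable) (auto intro!: fm[of _ x y])
    moreover have "measure lborel (N \<union> B) \<le> measure lborel N + measure lborel B"
      using B(1) Nb by (intro measure_Un_le) auto
    ultimately show ?thesis using B(4) by simp
  qed
  \<comment> \<open>The slope \<open>1/2\<close> separates the two densities \<open>3/4\<close> and
    \<open>1/4\<close>.\<close>
  define g where "g t = F t - t / 2" for t
  have diff: "\<bar>F y - F x\<bar> \<le> \<bar>y - x\<bar>" if "x \<in> {t1..t2}" "y \<in> {t1..t2}" for x y
    using that F\<mu>[of x y] F\<mu>[of y x] \<mu>le[of x y] \<mu>le[of y x] \<mu>0[of x y] \<mu>0[of y x] t(1) by (cases "x \<le> y") auto
  have "continuous_on {t1..t2} F"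
    unfolding continuous_on_iff
  proof (intro ballI allI impI)
    fix x e :: real assume "x \<in> {t1..t2}" "0 < e"
    then show "\<exists>d>0. \<forall>y\<in>{t1..t2}. dist y x < d \<longrightarrow> dist (F y) (F x) < e"
      using diff[of x] by (intro exI[of _ e]) (force simp: dist_real_def)
  qed
  then have "continuous_on {t1..t2} g" unfolding g_def by (intro continuous_intros) auto
  then obtain m where m: "m \<in> {t1..t2}" "\<And>y. y \<in> {t1..t2} \<Longrightarrow> g y \<le> g m"
    using continuous_attains_sup[of "{t1..t2}" g] t by auto
  have m01: "m \<in> {0..1}" using m t by auto
  then consider "\<gamma> m \<in> E1" | "\<gamma> m \<in> E2" using cover by blast
  then show False
  proof cases
    case 1
    \<comment> \<open>The endpoint \<open>t2\<close> belongs to \<open>E2\<close>, so there is room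
      to move right; symmetrically \<open>t1\<close> is excluded in the other case.\<close>
    have "m \<noteq> t2" using 1 t2 disj[OF m01] by auto
    obtain d where d: "0 < d" "\<And>y. y \<noteq> m \<Longrightarrow> \<bar>y - m\<bar> < d \<Longrightarrow>
      \<exists>B\<in>sets borel. {t \<in> closed_segment m y. \<gamma> t \<notin> E1} \<subseteq> B \<and> B \<subseteq> closed_segment m y \<and> measure lborel B \<le> \<bar>y - m\<bar> / 4"
      using plurifine_line_density[OF E(1), of p m b] 1 unfolding \<gamma>_def by blast
    define y where "y = min t2 (m + d / 2)"
    have y: "m < y" "y \<le> t2" "\<bar>y - m\<bar> < d" using \<open>m \<noteq> t2\<close> m(1) d(1) by (auto simp: y_def)
    then obtain B where B: "B\<in>sets borel" "{t \<in> {m..y}. \<gamma> t \<notin> E1} \<subseteq> B" "B \<subseteq> {m..y}" "measure lborel B \<le> (y - m) / 4"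
      using d(2)[of y] by (auto simp: closed_segment_eq_real_ivl)
    have "3/4 * (y - m) \<le> \<mu> m y" using y t m01 B by (intro low) auto
    then have "g m < g y" unfolding g_def using F\<mu>[of m y] m01 y(1) by (simp add: field_simps)
    then show False using m(2)[of y] y m(1) by auto
  next
    case 2
    have "m \<noteq> t1" using 2 t1 disj[OF m01] by auto
    obtain d where d: "0 < d" "\<And>y. y \<noteq> m \<Longrightarrow> \<bar>y - m\<bar> < d \<Longrightarrow>
      \<exists>B\<in>sets borel. {t \<in> closed_segment m y. \<gamma> t \<notin> E2} \<subseteq> B \<and> B \<subseteq> closed_segment m y \<and> measure lborel B \<le> \<bar>y - m\<bar> / 4"
      using plurifine_line_density[OF E(2), of p m b] 2 unfolding \<gamma>_def by blast
    define y where "y = max t1 (m - d / 2)"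
    have y: "y < m" "t1 \<le> y" "\<bar>y - m\<bar> < d" using \<open>m \<noteq> t1\<close> m(1) d(1) by (auto simp: y_def)
    then obtain B where B: "B\<in>sets borel" "{t \<in> {y..m}. \<gamma> t \<notin> E2} \<subseteq> B" "B \<subseteq> {y..m}" "measure lborel B \<le> (m - y) / 4"
      using d(2)[of y] by (auto simp: closed_segment_eq_real_ivl)
    have "\<mu> y m \<le> (m - y) / 4" using y t m01 B by (intro up) auto
    then have "g m < g y" unfolding g_def using F\<mu>[of y m] t(1) y(1,2) by (simp add: field_simps)
    then show False using m(2)[of y] y m(1) by auto
  qed
qed

lemma connectedin_plurifine_segment:
  fixes p b :: "complex ^ 'n"
  shows "connectedin plurifine_topology ((\<lambda>t. p + of_real t *s b) ` {0..1})" (is "connectedin _ (?\<gamma> ` _)")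
  unfolding connectedin
proof (intro conjI notI)
  show "?\<gamma> ` {0..1} \<subseteq> topspace plurifine_topology" by simp
  assume "\<exists>E1 E2. openin plurifine_topology E1 \<and> openin plurifine_topology E2 \<and> ?\<gamma> ` {0..1} \<subseteq> E1 \<union> E2 \<and>
     E1 \<inter> E2 \<inter> ?\<gamma> ` {0..1} = {} \<and> E1 \<inter> ?\<gamma> ` {0..1} \<noteq> {} \<and> E2 \<inter> ?\<gamma> ` {0..1} \<noteq> {}"
  then obtain E1 E2 where E: "openin plurifine_topology E1" "openin plurifine_topology E2"
    and cover: "?\<gamma> ` {0..1} \<subseteq> E1 \<union> E2" and disj: "E1 \<inter> E2 \<inter> ?\<gamma> ` {0..1} = {}"
    and "E1 \<inter> ?\<gamma> ` {0..1} \<noteq> {}" "E2 \<inter> ?\<gamma> ` {0..1} \<noteq> {}" by blast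
  then obtain t1 t2 where t: "t1 \<in> {0..1}" "?\<gamma> t1 \<in> E1" "t2 \<in> {0..1}" "?\<gamma> t2 \<in> E2" by blast
  have c: "?\<gamma> t \<in> E1 \<union> E2" "?\<gamma> t \<in> E2 \<union> E1" if "t \<in> {0..1}" for t
    using cover that by blast+
  have d: "\<not> (?\<gamma> t \<in> E1 \<and> ?\<gamma> t \<in> E2)" "\<not> (?\<gamma> t \<in> E2 \<and> ?\<gamma> t \<in> E1)" if "t \<in> {0..1}" for t
    using disj that by blast+
  have "t1 \<noteq> t2" using t d by blast
  then consider "t1 < t2" | "t2 < t1" by linarith
  then show False
  proof cases
    case 1
    show False
      by (rule no_plurifine_split_of_segment[OF E c(1) d(1) _ 1 _ t(2,4)]) (use t in auto)
  next
    case 2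
    show False
      by (rule no_plurifine_split_of_segment[OF E(2,1) c(2) d(2) _ 2 _ t(4,2)]) (use t in auto)
  qed
qed

section \<open>Components\<close>

text \<open>In the coordinate \<open>w\<close> of the complex line \<open>a + w *s b\<close> with
  \<open>b = z - a\<close>, the points are 0 and 1. A good ray leaves \<open>a\<close> with
  nonnegative slope, another leaves \<open>z\<close> in the direction \<open>- b\<close> with
  nonpositive slope. Both thus stay in the closed upper half plane over the interval from 0 to 1,
  and they must cross.\<close>

lemma plurifine_locally_connected:
  fixes \<Omega> :: "(complex ^ 'n) set"
  assumes "openin plurifine_topology \<Omega>" "a \<in> \<Omega>"
  obtains V where "openin plurifine_topology V" "a \<in> V"
    "\<And>z. z \<in> V \<Longrightarrow> \<exists>S. connectedin plurifine_topology S \<and> a \<in> S \<and> z \<in> S \<and> S \<subseteq> \<Omega>"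
proof -
  obtain \<Phi> R where \<Phi>: "rplurisubharmonic \<Phi>" and R: "0 < R" and \<Phi>0: "\<And>z. z \<in> ball a R \<Longrightarrow> \<Phi> z \<le> 0"
    and \<Phi>a: "- (1/36) < \<Phi> a" and \<Phi>\<Omega>: "\<And>z. z \<in> ball a R \<Longrightarrow> -1 \<le> \<Phi> z \<Longrightarrow> z \<in> \<Omega>"
    using plurifine_neighbourhood[OF assms, of "1/36"] by auto
  \<comment> \<open>The factor 11 leaves room for discs of radius 10 about both 0 and 1;
    \<open>1/36\<close> is the threshold of \<open>good_ray\<close>.\<close>
  define V where "V = ball a (R / 11) \<inter> {z. - (1/36) < \<Phi> z}"
  show ?thesis
  proof (rule that[of V])
    show "openin plurifine_topology V"
      unfolding V_def using \<Phi> by (intro openin_Int openin_plurifine_ball) (auto simp: rplurisubharmonic_def)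
    show "a \<in> V" using R \<Phi>a by (simp add: V_def)
    fix z assume z: "z \<in> V"
    define b where "b = z - a"
    have nb: "11 * norm b < R" and \<Phi>z: "- (1/36) < \<Phi> z"
      using z by (auto simp: V_def b_def dist_norm norm_minus_commute)
    have in_ball: "a + x \<in> ball a R" if "norm x < R" for x using that by (simp add: dist_norm)
    have near_a: "a + w *s b \<in> ball a R" if "norm w \<le> 10" for w
    proof -
      have "norm w * norm b \<le> 11 * norm b" using that by (intro mult_right_mono) auto
      then show ?thesis using nb by (intro in_ball) (simp add: norm_vector_scalar_mult)
    qed
    have near_z: "z + w *s (- b) \<in> ball a R" if "norm w \<le> 10" for w
    proof -
      have "z + w *s (- b) = a + (1 - w) *s b" by (simp add: b_def vec_eq_iff algebra_simps)
      moreover have "norm (1 - w) * norm b \<le> 11 * norm b"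
        using that norm_triangle_ineq4[of 1 w] by (intro mult_right_mono) auto
      then have "norm ((1 - w) *s b) < R" using nb by (simp only: norm_vector_scalar_mult)
      ultimately show ?thesis using in_ball[of "(1 - w) *s b"] by (simp only:)
    qed
    have small: "norm (Complex \<rho> (\<rho> * t)) \<le> 10" if "\<rho> \<in> {0..1}" "\<bar>t\<bar> \<le> 1" for \<rho> t
    proof -
      have "\<bar>\<rho> * t\<bar> \<le> 1" using that by (auto simp: abs_mult intro!: mult_le_one)
      then show ?thesis using cmod_le[of "Complex \<rho> (\<rho> * t)"] that by simp
    qed
    obtain t where t: "t \<in> {0..1}" and Ta: "\<And>\<rho>. \<rho> \<in> {0..1} \<Longrightarrow> -1 \<le> \<Phi> (a + Complex \<rho> (\<rho> * t) *s b)"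
    proof (rule good_ray[OF rplurisubharmonic_line[OF \<Phi>, of a b], of 0])
      show "\<Phi> (a + w *s b) \<le> 0" if "w \<in> cball 0 10" for w using that by (intro \<Phi>0 near_a) auto
    qed (use \<Phi>a in auto)
    obtain t' where t': "t' \<in> {-1..0}" and Tz: "\<And>\<rho>. \<rho> \<in> {0..1} \<Longrightarrow> -1 \<le> \<Phi> (z + Complex \<rho> (\<rho> * t') *s (- b))"
    proof (rule good_ray[OF rplurisubharmonic_line[OF \<Phi>, of z "- b"], of "-1"])
      show "\<Phi> (z + w *s (- b)) \<le> 0" if "w \<in> cball 0 10" for w using that by (intro \<Phi>0 near_z) auto
    qed (use \<Phi>z in auto)
    define S1 where "S1 = (\<lambda>\<rho>. a + of_real \<rho> *s (Complex 1 t *s b)) ` {0..1}"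
    define S2 where "S2 = (\<lambda>\<rho>. z + of_real \<rho> *s (Complex 1 t' *s (- b))) ` {0..1}"
    have C: "of_real \<rho> *s (Complex 1 s *s c) = Complex \<rho> (\<rho> * s) *s c" for \<rho> s and c :: "complex ^ 'n"
      by (simp add: vec_eq_iff complex_eq_iff algebra_simps)
    have "S1 \<subseteq> \<Omega>"
      unfolding S1_def C using t by (auto intro!: \<Phi>\<Omega> near_a small Ta)
    moreover have "S2 \<subseteq> \<Omega>"
      unfolding S2_def C using t' by (intro image_subsetI \<Phi>\<Omega> near_z small Tz) auto
    moreover have "connectedin plurifine_topology (S1 \<union> S2)"
    proof (rule connectedin_Un)
      show "connectedin plurifine_topology S1" "connectedin plurifine_topology S2"
        unfolding S1_def S2_def by (rule connectedin_plurifine_segment)+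
      \<comment> \<open>\<open>\<rho>\<close> is the abscissa at which the heights
        \<open>\<rho> * t\<close> and \<open>- ((1 - \<rho>) * t')\<close> agree. Equal slopes are
        both 0, and then any abscissa works.\<close>
      obtain \<rho> where \<rho>: "\<rho> \<in> {0..1}" "\<rho> * t = - ((1 - \<rho>) * t')"
      proof (cases "t = t'")
        case True
        then show ?thesis using t t' that[of 0] by auto
      next
        case False
        then have "t - t' > 0" using t t' by auto
        then show ?thesis using t t' by (intro that[of "- t' / (t - t')"]) (auto simp: field_simps)
      qed
      have "a + of_real \<rho> *s (Complex 1 t *s b) = z + of_real (1 - \<rho>) *s (Complex 1 t' *s (- b))"
      proof -
        have "Complex \<rho> (\<rho> * t) = 1 - Complex (1 - \<rho>) ((1 - \<rho>) * t')"
          using \<rho>(2) by (simp add: complex_eq_iff)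
        moreover have "a + u *s b = z + u' *s (- b)" if "u = 1 - u'" for u u'
          by (simp add: that b_def vec_eq_iff algebra_simps)
        ultimately show ?thesis unfolding C by blast
      qed
      moreover have "a + of_real \<rho> *s (Complex 1 t *s b) \<in> S1"
        unfolding S1_def using \<rho>(1) by (rule imageI)
      moreover have "z + of_real (1 - \<rho>) *s (Complex 1 t' *s (- b)) \<in> S2"
        unfolding S2_def by (rule imageI) (use \<rho>(1) in auto)
      ultimately show "S1 \<inter> S2 \<noteq> {}" by (metis IntI empty_iff)
    qed
    moreover have "a \<in> S1" unfolding S1_def by (rule image_eqI[of _ _ 0]) simp_all
    moreover have "z \<in> S2" unfolding S2_def by (rule image_eqI[of _ _ 0]) simp_all
    ultimately show "\<exists>S. connectedin plurifine_topology S \<and> a \<in> S \<and> z \<in> S \<and> S \<subseteq> \<Omega>"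
      by (intro exI[of _ "S1 \<union> S2"]) simp
  qed
qed

section \<open>Positive Lebesgue measure and countability\<close>

lemma negligible_rotation:
  fixes N :: "(complex ^ 'n) set"
  assumes "negligible N"
  shows "negligible {b. a + cis t *s b \<in> N}"
proof -
  have "linear (\<lambda>z :: complex ^ 'n. cis (- t) *s z)"
    by (intro linearI) (auto simp: vec_eq_iff algebra_simps)
  then have "(\<lambda>z. cis (- t) *s z) differentiable_on (+) (- a) ` N"
    by (rule linear_imp_differentiable_on)
  then have "negligible ((\<lambda>z. cis (- t) *s z) ` (+) (- a) ` N)"
    using assms by (intro negligible_differentiable_image_negligible negligible_translation) auto
  moreover have "{b. a + cis t *s b \<in> N} \<subseteq> (\<lambda>z. cis (- t) *s z) ` (+) (- a) ` N"
  proof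
    fix b assume "b \<in> {b. a + cis t *s b \<in> N}"
    moreover have "b = cis (- t) *s (- a + (a + cis t *s b))"
      by (simp add: vector_ssub_ldistrib cis_mult)
    ultimately show "b \<in> (\<lambda>z. cis (- t) *s z) ` (+) (- a) ` N" by blast
  qed
  ultimately show ?thesis by (rule negligible_subset)
qed

text \<open>The part of a ball where \<open>\<Phi> \<ge> -1\<close> cannot be null. Otherwise almost
  every circle \<open>a + cis t *s b\<close> in the ball would avoid it for almost all
  \<open>t\<close>, and the mean value inequality on one such circle would give
  \<open>\<Phi> a \<le> -1\<close>.\<close>

lemma plurifine_open_contains_nonnegligible:
  fixes \<Omega> :: "(complex ^ 'n) set"
  assumes "openin plurifine_topology \<Omega>" "\<Omega> \<noteq> {}"
  obtains N where "N \<in> sets borel" "N \<subseteq> \<Omega>" "\<not> negligible N"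
proof -
  obtain a where a: "a \<in> \<Omega>" using assms by blast
  obtain \<Phi> R where \<Phi>: "rplurisubharmonic \<Phi>" and R: "0 < R"
    and \<Phi>a: "- 1 < \<Phi> a" and \<Phi>\<Omega>: "\<And>z. z \<in> ball a R \<Longrightarrow> -1 \<le> \<Phi> z \<Longrightarrow> z \<in> \<Omega>"
    by (rule plurifine_neighbourhood[OF assms(1) a zero_less_one]) blast
  have \<Phi>m[measurable]: "\<Phi> \<in> borel_measurable borel"
    using \<Phi> by (intro usc_borel_measurable) (simp add: rplurisubharmonic_def)
  define N where "N = {z \<in> ball a R. -1 \<le> \<Phi> z}"
  have Nb[measurable]: "N \<in> sets borel" unfolding N_def by measurable
  have "\<not> negligible N"
  proof
    assume N0: "negligible N"
    have [measurable]: "(\<lambda>(t, b). a + cis t *s b) \<in> borel_measurable (borel \<Otimes>\<^sub>M borel)"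
      unfolding borel_prod vector_scalar_mult_def
      by (intro borel_measurable_continuous_onI) (auto simp: split_beta intro!: continuous_intros)
    define f where "f t b = (indicator {0..2*pi} t * indicator N (a + cis t *s b) :: ennreal)" for t b
    have fm[measurable]: "(\<lambda>(t, b). f t b) \<in> borel_measurable (borel \<Otimes>\<^sub>M borel)"
      unfolding f_def by measurable
    have f0: "(\<integral>\<^sup>+b. f t b \<partial>lborel) = 0" for t
    proof -
      have "{b. a + cis t *s b \<in> N} \<in> sets borel"
      proof -
        have "continuous_on UNIV (\<lambda>b. a + cis t *s b)"
          unfolding vector_scalar_mult_def by (intro continuous_intros)
        then show ?thesis
          using measurable_sets[OF borel_measurable_continuous_onI Nb] by (simp add: vimage_def)
      qed
      then have "AE b in lborel. a + cis t *s b \<notin> N"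
        using negligible_rotation[OF N0, of a t]
        by (intro AE_I[where N = "{b. a + cis t *s b \<in> N}"]) (auto simp: negligible_iff_emeasure0)
      then show ?thesis
      proof -
        have "(\<integral>\<^sup>+b. f t b \<partial>lborel) = (\<integral>\<^sup>+b. 0 \<partial>(lborel :: (complex ^ 'n) measure))"
        proof (rule nn_integral_cong_AE)
          show "AE b in lborel. f t b = 0"
            using \<open>AE b in lborel. a + cis t *s b \<notin> N\<close> by eventually_elim (simp add: f_def)
        qed
        then show ?thesis by simp
      qed
    qed
    \<comment> \<open>For fixed \<open>t\<close> the vectors \<open>b\<close> hitting
      \<open>N\<close> form a null set; exchanging the integrals yields the statement for almost
      every \<open>b\<close>.\<close>
    have "(\<integral>\<^sup>+b. (\<integral>\<^sup>+t. f t b \<partial>lborel) \<partial>lborel) = (\<integral>\<^sup>+t. (\<integral>\<^sup>+b. f t b \<partial>lborel) \<partial>lborel)"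
      by (rule lborel_pair.Fubini') (simp add: fm)
    then have "AE b in lborel. (\<integral>\<^sup>+t. f t b \<partial>lborel) = 0"
      by (subst nn_integral_0_iff_AE[symmetric]) (simp_all add: f0)
    then have "AE b in lebesgue. (\<integral>\<^sup>+t. f t b \<partial>lborel) = 0" by (rule AE_completion)
    then have "negligible {b. \<not> (\<integral>\<^sup>+t. f t b \<partial>lborel) = 0}"
      by (simp add: negligible_iff_null_sets AE_iff_null_sets)
    moreover have "\<not> negligible (ball (0 :: complex ^ 'n) R)"
      using R by (intro open_not_negligible) auto
    ultimately have "\<not> ball 0 R \<subseteq> {b. \<not> (\<integral>\<^sup>+t. f t b \<partial>lborel) = 0}"
      using negligible_subset by metis
    then obtain b where b: "b \<in> ball 0 R" "(\<integral>\<^sup>+t. f t b \<partial>lborel) = 0"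
      by auto
    have "AE t in lborel. f t b = 0"
      using b(2) by (subst (asm) nn_integral_0_iff_AE) simp_all
    then have "AE t in lborel. t \<in> {0..2*pi} \<longrightarrow> \<Phi> (a + cis t *s b) \<le> -1"
    proof eventually_elim
      case (elim t)
      have "a + cis t *s b \<in> ball a R" using b(1) by (simp add: dist_norm norm_vector_scalar_mult)
      then show ?case using elim by (auto simp: f_def N_def split: split_indicator_asm)
    qed
    moreover note int = rplurisubharmonic_integrable[OF \<Phi>, of a b]
    ultimately have "(LINT t:{0..2*pi}|lborel. \<Phi> (a + cis t *s b)) \<le> (LINT t:{0..2*pi}|lborel. -1)"
      by (intro set_integral_mono_AE) (auto intro!: borel_integrable_atLeastAtMost')
    then have "integral {0..2*pi} (\<lambda>t. \<Phi> (a + cis t *s b)) \<le> 2 * pi * (-1)"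
      unfolding set_borel_integral_eq_integral(2)[OF int] by (simp add: set_lebesgue_integral_def)
    moreover have "2 * pi * \<Phi> a \<le> integral {0..2*pi} (\<lambda>t. \<Phi> (a + cis t *s b))"
      using \<Phi> unfolding rplurisubharmonic_def by blast
    ultimately have "2 * pi * \<Phi> a \<le> 2 * pi * (-1)" by linarith
    then have "\<Phi> a \<le> -1" by (subst (asm) mult_le_cancel_left_pos) simp_all
    then show False using \<Phi>a by simp
  qed
  then show ?thesis using that[of N] Nb \<Phi>\<Omega> by (auto simp: N_def)
qed

text \<open>Within a fixed ball the measures of finitely many of the disjoint sets add up to at most
  the measure of the ball, so the whole family is summable and only countably many terms are
  nonzero. Every member has a nonzero term for some radius \<open>k\<close>.\<close>

lemma countable_disjoint_nonnegligible:
  fixes \<C> :: "'a::euclidean_space set set"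
  assumes disj: "pairwise disjnt \<C>" and N: "\<And>C. C \<in> \<C> \<Longrightarrow> \<exists>N\<in>sets borel. N \<subseteq> C \<and> \<not> negligible N"
  shows "countable \<C>"
proof -
  obtain N where N: "\<And>C. C \<in> \<C> \<Longrightarrow> N C \<in> sets borel \<and> N C \<subseteq> C \<and> \<not> negligible (N C)"
    using N by metis
  define M where "M k C = N C \<inter> ball 0 (real k)" for k C
  have Mm: "M k C \<in> lmeasurable" if "C \<in> \<C>" for k C
    using N[OF that] unfolding M_def
    by (intro bounded_set_imp_lmeasurable) (auto intro: bounded_subset[OF bounded_ball])
  have "countable {C\<in>\<C>. measure lebesgue (M k C) \<noteq> 0}" for k
  proof (rule abs_summable_countable)
    show "(\<lambda>C. norm (measure lebesgue (M k C))) summable_on \<C>"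
    proof (rule nonneg_bdd_above_summable_on[OF norm_ge_zero], rule bdd_aboveI2)
      fix F assume "F \<in> {F. F \<subseteq> \<C> \<and> finite F}"
      then have F: "F \<subseteq> \<C>" "finite F" by auto
      have "disjoint_family_on (M k) F"
        using disj F N unfolding disjoint_family_on_def pairwise_def disjnt_def M_def by blast
      then have "(\<Sum>C\<in>F. measure lebesgue (M k C)) = measure lebesgue (\<Union>C\<in>F. M k C)"
        using F Mm by (intro measure_UNION'[symmetric]) (auto simp: disjoint_family_on_def pairwise_def disjnt_def)
      also have "\<dots> \<le> measure lebesgue (ball 0 (real k) :: 'a set)"
      proof (rule measure_mono_fmeasurable)
        show "(\<Union>C\<in>F. M k C) \<in> sets lebesgue"
          using F Mm by (intro sets.finite_UN) (auto intro: fmeasurableD)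
      qed (auto simp: M_def)
      finally show "(\<Sum>C\<in>F. norm (measure lebesgue (M k C))) \<le> measure lebesgue (ball 0 (real k) :: 'a set)"
        by simp
    qed
  qed
  then have "countable (\<Union>k. {C\<in>\<C>. measure lebesgue (M k C) \<noteq> 0})" by blast
  moreover have "\<C> \<subseteq> (\<Union>k. {C\<in>\<C>. measure lebesgue (M k C) \<noteq> 0})"
  proof
    fix C assume C: "C \<in> \<C>"
    have "N C = (\<Union>k. M k C)"
      unfolding M_def using reals_Archimedean2 by (auto simp: mem_ball_0)
    then obtain k where "\<not> negligible (M k C)"
      using N[OF C] negligible_countable_Union[of "range (\<lambda>k. M k C)"] by auto
    then show "C \<in> (\<Union>k. {C\<in>\<C>. measure lebesgue (M k C) \<noteq> 0})"
      using C Mm[OF C] negligible_iff_measure0 by blast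
  qed
  ultimately show ?thesis by (rule countable_subset[rotated])
qed

theorem corollary1p2:
  fixes \<Omega> :: "(complex ^ 'n) set"
  assumes "openin plurifine_topology \<Omega>"
  shows "(\<forall>C \<in> connected_components_of (subtopology plurifine_topology \<Omega>).
            openin plurifine_topology C)
       \<and> countable (connected_components_of (subtopology plurifine_topology \<Omega>))"
proof -
  let ?\<C> = "connected_components_of (subtopology plurifine_topology \<Omega>)"
  have op: "openin plurifine_topology C" if C: "C \<in> ?\<C>" for C
  proof (subst openin_subopen, intro ballI)
    fix a assume "a \<in> C"
    then have "a \<in> \<Omega>" using connected_components_of_subset[OF C] by auto
    obtain V where V: "openin plurifine_topology V" "a \<in> V"
      "\<And>z. z \<in> V \<Longrightarrow> \<exists>S. connectedin plurifine_topology S \<and> a \<in> S \<and> z \<in> S \<and> S \<subseteq> \<Omega>"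
      using plurifine_locally_connected[OF assms \<open>a \<in> \<Omega>\<close>] by blast
    \<comment> \<open>Each point of \<open>V\<close> shares with \<open>a\<close> a connected subset
      of \<open>\<Omega>\<close>, which the maximality of the component places inside
      \<open>C\<close>.\<close>
    have "V \<subseteq> C"
    proof
      fix z assume "z \<in> V"
      then obtain S where S: "connectedin plurifine_topology S" "a \<in> S" "z \<in> S" "S \<subseteq> \<Omega>" using V(3) by blast
      then have "connectedin (subtopology plurifine_topology \<Omega>) S" by (simp add: connectedin_subtopology)
      then have "S \<subseteq> C"
        using connected_components_of_maximal[OF C] S(2) \<open>a \<in> C\<close> by (auto simp: disjnt_def)
      then show "z \<in> C" using S(3) by blast
    qed
    then show "\<exists>V. openin plurifine_topology V \<and> a \<in> V \<and> V \<subseteq> C"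
      using V(1,2) by (intro exI[of _ V]) simp
  qed
  moreover have "countable ?\<C>"
  proof (rule countable_disjoint_nonnegligible[OF pairwise_disjoint_connected_components_of])
    fix C assume C: "C \<in> ?\<C>"
    show "\<exists>N\<in>sets borel. N \<subseteq> C \<and> \<not> negligible N"
    proof (rule plurifine_open_contains_nonnegligible[OF op[OF C] nonempty_connected_components_of[OF C]])
      fix N assume "N \<in> sets borel" "N \<subseteq> C" "\<not> negligible N"
      then show ?thesis by (intro bexI[of _ N]) simp_all
    qed
  qed
  ultimately show ?thesis by blast
qed

end
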